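(* For every $k\in(0,\tfrac12)$ and every $K\ge1$, the metric measure space $(X_{k,0},\mathsf d_\infty,\mathfrak m_{k,K,0})$ is not a strict $\mathsf{CD}(0,\infty)$ space.
   Context: Spaces. For each $k\in(0,\tfrac12)$ fix a continuous function $\varphi_k:\mathbb R\to[0,1]$ with $\int_{\mathbb R}\varphi_k=k$ and $\varphi_k=0$ outside $[-k,k]$. Let $f_{k,0}:[-1,1]\to[0,\infty)$ be the $C^2$ function with $f_{k,0}''=\varphi_k$, $f_{k,0}'(-1)=0$, $f_{k,0}(-1)=0$. Set $X_{k,0}=\{(x,y)\in\mathbb R^2: x\in[-1,1],\ 0\le y\le f_{k,0}(x)\}$, with distance $\mathsf d_\infty((x_0,y_0),(x_1,y_1))=\max\{|x_0-x_1|,|y_0-y_1|\}$. For $K\ge1$ let $C_K=\int_0^1e^{-Ky^2}\,dy$ and let $\mathfrak m_{k,K,0}$ be the Borel measure on $X_{k,0}$ which equals $C_K\mathcal H^1$ (one-dimensional Hausdorff measure) on the segment $\{(x,0): f_{k,0}(x)=0\}$ and equals $\frac{1}{f_{k,0}(x)}\exp\big(-K(y/f_{k,0}(x))^2\big)\mathscr L^2$ on $X_{k,0}\cap\{f_{k,0}(x)>0\}$, $\mathscr L^2$ being Lebesgue measure. Strict $\mathsf{CD}$. For a compact metric measure space $(X,\mathsf d,\mathfrak m)$, $\mathscr P_2(X)$ is the set of Borel probability measures (with finite second moment), $W_2$ the quadratic Wasserstein distance, $\mathrm{Ent}(\mu)=\int\rho\log\rho\,d\mathfrak m$ if $\mu=\rho\mathfrak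 m$ and $+\infty$ otherwise. $\mathrm{Geo}(X)$ is the space of constant speed geodesics $[0,1]\to X$, $e_t(\gamma)=\gamma(t)$, and $\mathrm{OptGeo}(\mu_0,\mu_1)$ is the set of Borel probability measures $\eta$ on $C([0,1],X)$ concentrated on $\mathrm{Geo}(X)$ such that $(e_0,e_1)_\#\eta$ is an optimal transport plan between $\mu_0$ and $\mu_1$ for the cost $\mathsf d^2$. The space is a strict $\mathsf{CD}(R,\infty)$ space, $R\in\mathbb R$, if for every $\mu_0,\mu_1\in\mathscr P_2(X)$ absolutely continuous w.r.t. $\mathfrak m$ there exists $\eta\in\mathrm{OptGeo}(\mu_0,\mu_1)$ such that for every bounded measurable $F:\mathrm{Geo}(X)\to[0,\infty)$ with $\int F\,d\eta=1$, setting $\nu_t=(e_t)_\#(F\eta)$, one has $\mathrm{Ent}(\nu_t)\le(1-t)\mathrm{Ent}(\nu_0)+t\,\mathrm{Ent}(\nu_1)-\frac R2t(1-t)W_2^2(\nu_0,\nu_1)$ for every $t\in[0,1]$. *)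

theory Defs
  imports "HOL-Probability.Probability"
begin

section \<open>Metric measure spaces and optimal transport\<close>

definition borel_of_metric :: "'a metric \<Rightarrow> 'a measure" where
  "borel_of_metric X = sigma (mspace X) {U. openin (mtopology_of X) U}"

definition P2 :: "'a metric \<Rightarrow> 'a measure set" where
  "P2 X = {\<mu>. prob_space \<mu> \<and> sets \<mu> = sets (borel_of_metric X) \<and>
     (\<exists>x0\<in>mspace X. (\<integral>\<^sup>+ x. ennreal ((mdist X x x0)\<^sup>2) \<partial>\<mu>) < \<infinity>)}"

text \<open>For the separable spaces considered here the Borel \<open>\<sigma>\<close>-algebra of the product
  is the product of the Borel \<open>\<sigma>\<close>-algebras, so plans live on the latter.\<close>

definition plans :: "'a metric \<Rightarrow> 'a measure \<Rightarrow> 'a measure \<Rightarrow> ('a \<times> 'a) measure set" where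
  "plans X \<mu> \<nu> = {\<pi>. prob_space \<pi> \<and>
     sets \<pi> = sets (borel_of_metric X \<Otimes>\<^sub>M borel_of_metric X) \<and>
     distr \<pi> (borel_of_metric X) fst = \<mu> \<and> distr \<pi> (borel_of_metric X) snd = \<nu>}"

definition transport_cost :: "'a metric \<Rightarrow> ('a \<times> 'a) measure \<Rightarrow> ennreal" where
  "transport_cost X \<pi> = (\<integral>\<^sup>+ p. ennreal ((mdist X (fst p) (snd p))\<^sup>2) \<partial>\<pi>)"

definition optimal_plan :: "'a metric \<Rightarrow> 'a measure \<Rightarrow> 'a measure \<Rightarrow> ('a \<times> 'a) measure \<Rightarrow> bool" where
  "optimal_plan X \<mu> \<nu> \<pi> \<longleftrightarrow> \<pi> \<in> plans X \<mu> \<nu> \<and>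
     (\<forall>\<pi>'\<in>plans X \<mu> \<nu>. transport_cost X \<pi> \<le> transport_cost X \<pi>')"

definition W2 :: "'a metric \<Rightarrow> 'a measure \<Rightarrow> 'a measure \<Rightarrow> real" where
  "W2 X \<mu> \<nu> = sqrt (enn2real (INF \<pi>\<in>plans X \<mu> \<nu>. transport_cost X \<pi>))"

text \<open>The integral of \<open>\<rho> log \<rho>\<close> is taken as positive part minus negative part; the latter is
  finite whenever \<open>m\<close> is finite. Note that \<open>ln 0 = 0\<close>, so \<open>0 log 0 = 0\<close>.\<close>

definition Ent :: "'a measure \<Rightarrow> 'a measure \<Rightarrow> ereal" where
  "Ent m \<mu> = (if \<exists>\<rho>\<in>borel_measurable m. \<mu> = density m \<rho> then
     (let \<rho> = (\<lambda>x. enn2real (RN_deriv m \<mu> x)) in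
       enn2ereal (\<integral>\<^sup>+ x. ennreal (\<rho> x * ln (\<rho> x)) \<partial>m)
       - enn2ereal (\<integral>\<^sup>+ x. ennreal (- (\<rho> x * ln (\<rho> x))) \<partial>m))
     else \<infinity>)"

section \<open>Geodesics and the strict CD condition\<close>

text \<open>\<open>C([0,1],X)\<close> with the supremum distance; its elements are extensional functions.\<close>

definition curves :: "'a metric \<Rightarrow> (real \<Rightarrow> 'a) metric" where
  "curves X = cfunspace (top_of_set {0..1}) X"

definition Geo :: "'a metric \<Rightarrow> (real \<Rightarrow> 'a) set" where
  "Geo X = {\<gamma> \<in> mspace (curves X). \<forall>s\<in>{0..1}. \<forall>t\<in>{0..1}.
     mdist X (\<gamma> s) (\<gamma> t) = \<bar>s - t\<bar> * mdist X (\<gamma> 0) (\<gamma> 1)}"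

definition OptGeo :: "'a metric \<Rightarrow> 'a measure \<Rightarrow> 'a measure \<Rightarrow> (real \<Rightarrow> 'a) measure set" where
  "OptGeo X \<mu> \<nu> = {\<eta>. prob_space \<eta> \<and> sets \<eta> = sets (borel_of_metric (curves X)) \<and>
     (AE \<gamma> in \<eta>. \<gamma> \<in> Geo X) \<and>
     optimal_plan X \<mu> \<nu>
       (distr \<eta> (borel_of_metric X \<Otimes>\<^sub>M borel_of_metric X) (\<lambda>\<gamma>. (\<gamma> 0, \<gamma> 1)))}"

text \<open>The push-forward of \<open>F \<eta>\<close> under evaluation at \<open>t\<close>; as \<open>F\<close> is only given on \<open>Geo X\<close>, the
  measure \<open>\<eta>\<close>, which is concentrated on \<open>Geo X\<close>, is restricted to that set first.\<close>

definition weighted_marginal ::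
    "'a metric \<Rightarrow> (real \<Rightarrow> 'a) measure \<Rightarrow> ((real \<Rightarrow> 'a) \<Rightarrow> real) \<Rightarrow> real \<Rightarrow> 'a measure" where
  "weighted_marginal X \<eta> F t =
     distr (density (restrict_space \<eta> (Geo X)) (\<lambda>\<gamma>. ennreal (F \<gamma>))) (borel_of_metric X) (\<lambda>\<gamma>. \<gamma> t)"

definition strict_CD :: "real \<Rightarrow> 'a metric \<Rightarrow> 'a measure \<Rightarrow> bool" where
  "strict_CD R X m \<longleftrightarrow>
    (\<forall>\<mu>0\<in>P2 X. \<forall>\<mu>1\<in>P2 X. absolutely_continuous m \<mu>0 \<longrightarrow> absolutely_continuous m \<mu>1 \<longrightarrow>
      (\<exists>\<eta>\<in>OptGeo X \<mu>0 \<mu>1.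
        \<forall>F :: (real \<Rightarrow> 'a) \<Rightarrow> real.
          F \<in> borel_measurable (restrict_space (borel_of_metric (curves X)) (Geo X)) \<longrightarrow>
          (\<forall>\<gamma>\<in>Geo X. 0 \<le> F \<gamma>) \<longrightarrow>
          (\<exists>B. \<forall>\<gamma>\<in>Geo X. F \<gamma> \<le> B) \<longrightarrow>
          (\<integral>\<^sup>+ \<gamma>. ennreal (F \<gamma>) \<partial>restrict_space \<eta> (Geo X)) = 1 \<longrightarrow>
          (let \<nu> = weighted_marginal X \<eta> F in
            \<forall>t\<in>{0..1}.
              Ent m (\<nu> t) \<le> ereal (1 - t) * Ent m (\<nu> 0) + ereal t * Ent m (\<nu> 1)
                - ereal (R / 2 * t * (1 - t) * (W2 X (\<nu> 0) (\<nu> 1))\<^sup>2))))"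

section \<open>One-dimensional Hausdorff measure\<close>

definition ediam :: "'a metric \<Rightarrow> 'a set \<Rightarrow> ennreal" where
  "ediam X S = (SUP x\<in>S. SUP y\<in>S. ennreal (mdist X x y))"

definition hausdorff1_pre :: "'a metric \<Rightarrow> real \<Rightarrow> 'a set \<Rightarrow> ennreal" where
  "hausdorff1_pre X \<delta> A =
     (INF E\<in>{E :: nat \<Rightarrow> 'a set. A \<subseteq> (\<Union>i. E i) \<and>
              (\<forall>i. E i \<subseteq> mspace X \<and> ediam X (E i) \<le> ennreal \<delta>)}.
        \<Sum>i. ediam X (E i))"

definition hausdorff1 :: "'a metric \<Rightarrow> 'a set \<Rightarrow> ennreal" where
  "hausdorff1 X A = (SUP \<delta>\<in>{0<..}. hausdorff1_pre X \<delta> A)"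

section \<open>The space under the graph of a profile function\<close>

definition d_inf :: "real \<times> real \<Rightarrow> real \<times> real \<Rightarrow> real" where
  "d_inf p q = max \<bar>fst p - fst q\<bar> \<bar>snd p - snd q\<bar>"

definition subgraph :: "(real \<Rightarrow> real) \<Rightarrow> (real \<times> real) set" where
  "subgraph f = {(x, y). x \<in> {-1..1} \<and> 0 \<le> y \<and> y \<le> f x}"

definition subgraph_space :: "(real \<Rightarrow> real) \<Rightarrow> (real \<times> real) metric" where
  "subgraph_space f = metric (subgraph f, d_inf)"

lemma Metric_space_d_inf: "Metric_space M d_inf"
  by unfold_locales (auto simp: d_inf_def prod_eq_iff)

lemma mspace_subgraph_space [simp]: "mspace (subgraph_space f) = subgraph f"
  and mdist_subgraph_space [simp]: "mdist (subgraph_space f) = d_inf"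
  by (simp_all add: subgraph_space_def Metric_space.mspace_metric Metric_space.mdist_metric
        Metric_space_d_inf)

text \<open>\<open>measure_of\<close> collapses to the zero measure unless the given set function is a measure on
  the Borel sets. Here it is one: Borel sets of the space are Borel in the plane, and Hausdorff
  measure, being a metric outer measure, is countably additive on Borel sets.\<close>

definition subgraph_measure :: "(real \<Rightarrow> real) \<Rightarrow> real \<Rightarrow> (real \<times> real) measure" where
  "subgraph_measure f K =
     measure_of (subgraph f) (sets (borel_of_metric (subgraph_space f)))
       (\<lambda>A. ennreal (integral {0..1} (\<lambda>y. exp (- K * y\<^sup>2))) *
              hausdorff1 (subgraph_space f) (A \<inter> {(x, y). x \<in> {-1..1} \<and> f x = 0 \<and> y = 0})
          + (\<integral>\<^sup>+ p \<in> A \<inter> {(x, y). f x > 0}.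
              ennreal (1 / f (fst p) * exp (- K * (snd p / f (fst p))\<^sup>2)) \<partial>lborel))"

end

theory Submission
  imports Defs
begin

text \<open>In the coordinates \<open>(x, s) = (x, y / f x)\<close> the reference measure is the product of the length
  \<open>dx\<close> and \<open>exp (- K * s\<^sup>2) ds\<close>. Transport the uniform measure on a piece \<open>[-1, -1 + h]\<close> of the
  needle onto the uniform measure on the part of the space above \<open>[1 - h, 1]\<close>. Since \<open>f\<close> is flat, the
  distance between the two supports is realised by the first coordinate, so every optimal geodesic
  moves its first coordinate with constant speed \<open>L = 2 - h\<close>, and all the fibre information is created
  on the way. At a time \<open>\<tau> < 1\<close> at which the mass has already left the needle, cut each fibre in two halves of
  equal mass and select, for each starting point, the half that receives at least one half of the
  geodesics; reweight the selected geodesics such that the starting measure is unchanged. The weight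
  is at most 2, so the final entropy grows by at most \<open>ln 2\<close>, the initial entropy is unchanged, but the
  entropy at time \<open>\<tau>\<close> is larger by at least \<open>ln 2\<close> than the initial one because the support has half the mass.
  Convexity along the geodesics would give \<open>ln 2 \<le> \<tau> * ln 2\<close>.\<close>

section \<open>Borel sets of metric spaces and of curves\<close>

text \<open>The hypothesis supplies \<open>\<eta>\<close> before the weight is chosen, and the
  maximum distance leaves vertical motion undetermined, so only facts valid for every optimal
  \<open>\<eta>\<close> can be used. Horizontal motion is such a fact: the marginals fix its mean to
  be \<open>L\<close>, while the optimal cost is at most \<open>L\<^sup>2\<close>, which is the
  equality case of Jensen's inequality. Since all mass starts at height 0, the first coordinate at
  time \<open>\<tau>\<close> determines the starting point; a choice of half that depends on the
  starting point alone therefore leaves one half of every fibre. Two halves give the factor 2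
  because one of two complementary events has conditional probability at least 1/2, and the weight
  is the inverse of that probability. How the selected mass is spread inside its half is unknown, so
  the entropy at time \<open>\<tau>\<close> is bounded below through the measure of the support
  only. With \<open>c\<close> the common constant density of the two end measures, convexity would
  read \<open>ln (2 * c) \<le> (1 - \<tau>) * ln c + \<tau> * ln (2 * c)\<close>.\<close>

lemma space_borel_of_metric [simp]: "space (borel_of_metric X) = mspace X"
  by (simp add: borel_of_metric_def space_measure_of_conv)

lemma sets_borel_of_metric:
  "sets (borel_of_metric X) = sigma_sets (mspace X) {U. openin (mtopology_of X) U}"
proof -
  have "{U. openin (mtopology_of X) U} \<subseteq> Pow (mspace X)"
    using openin_subset by fastforce
  then show ?thesis
    by (simp add: borel_of_metric_def sets_measure_of_conv)
qed

lemma openin_sets_borel_of_metric: "openin (mtopology_of X) U \<Longrightarrow> U \<in> sets (borel_of_metric X)"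
  by (auto simp: sets_borel_of_metric)

lemma closedin_sets_borel_of_metric:
  assumes "closedin (mtopology_of X) U" shows "U \<in> sets (borel_of_metric X)"
proof -
  have "mspace X - U \<in> sets (borel_of_metric X)"
    using assms by (intro openin_sets_borel_of_metric) (auto simp: closedin_def)
  then have "space (borel_of_metric X) - (mspace X - U) \<in> sets (borel_of_metric X)"
    by (rule sets.compl_sets)
  moreover have "space (borel_of_metric X) - (mspace X - U) = U"
    using closedin_subset[OF assms] by auto
  ultimately show ?thesis by simp
qed

lemma continuous_map_measurable_borel_of_metric:
  assumes "continuous_map (mtopology_of X) (mtopology_of Y) g"
  shows "g \<in> borel_of_metric X \<rightarrow>\<^sub>M borel_of_metric Y"
  unfolding borel_of_metric_def[of Y]
proof (rule measurable_measure_of)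
  show "{U. openin (mtopology_of Y) U} \<subseteq> Pow (mspace Y)"
    using openin_subset by fastforce
  show "g \<in> space (borel_of_metric X) \<rightarrow> mspace Y"
    using assms continuous_map_image_subset_topspace by fastforce
  fix U assume "U \<in> {U. openin (mtopology_of Y) U}"
  then have "openin (mtopology_of X) {x \<in> topspace (mtopology_of X). g x \<in> U}"
    using assms by (auto simp: continuous_map_def)
  then show "g -` U \<inter> space (borel_of_metric X) \<in> sets (borel_of_metric X)"
    by (auto dest!: openin_sets_borel_of_metric simp: vimage_def Int_def conj_commute)
qed

lemma continuous_map_curves_eval:
  assumes t: "t \<in> {0..1}"
  shows "continuous_map (mtopology_of (curves X)) (mtopology_of X) (\<lambda>\<gamma>. \<gamma> t)"
proof -
  have "Lipschitz_continuous_map (curves X) X (\<lambda>\<gamma>. \<gamma> t)"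
    unfolding Lipschitz_continuous_map_def
  proof (intro conjI exI[of _ 1] ballI)
    show "(\<lambda>\<gamma>. \<gamma> t) \<in> mspace (curves X) \<rightarrow> mspace X"
      using t by (auto simp: curves_def)
    fix \<gamma> \<delta> assume "\<gamma> \<in> mspace (curves X)" "\<delta> \<in> mspace (curves X)"
    then show "mdist X (\<gamma> t) (\<delta> t) \<le> 1 * mdist (curves X) \<gamma> \<delta>"
      unfolding curves_def using t by (simp add: mdist_cfunspace_imp_mdist_le del: mspace_cfunspace)
  qed
  then show ?thesis
    by (simp add: Lipschitz_continuous_imp_continuous_map)
qed

lemma measurable_curves_eval:
  "t \<in> {0..1} \<Longrightarrow> (\<lambda>\<gamma>. \<gamma> t) \<in> borel_of_metric (curves X) \<rightarrow>\<^sub>M borel_of_metric X"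
  by (intro continuous_map_measurable_borel_of_metric continuous_map_curves_eval)

text \<open>The conditions defining a geodesic are uncountably many, so measurability is obtained
  from closedness: each condition is the zero set of a function that is continuous for the uniform
  distance.\<close>

lemma sets_Geo: "Geo X \<in> sets (borel_of_metric (curves X))"
proof -
  let ?C = "\<lambda>s t. {\<gamma> \<in> mspace (curves X). mdist X (\<gamma> s) (\<gamma> t) - \<bar>s - t\<bar> * mdist X (\<gamma> 0) (\<gamma> 1) \<in> {0}}"
  have cd: "continuous_map (mtopology_of (curves X)) euclideanreal (\<lambda>\<gamma>. mdist X (\<gamma> s) (\<gamma> t))"
    if "s \<in> {0..1}" "t \<in> {0..1}" for s t
    using continuous_map_mdist[OF continuous_map_curves_eval continuous_map_curves_eval] that by blast
  have "closedin (mtopology_of (curves X)) (?C s t)" if "s \<in> {0..1}" "t \<in> {0..1}" for s t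
  proof -
    have "continuous_map (mtopology_of (curves X)) euclideanreal
        (\<lambda>\<gamma>. mdist X (\<gamma> s) (\<gamma> t) - \<bar>s - t\<bar> * mdist X (\<gamma> 0) (\<gamma> 1))"
      using that by (intro continuous_map_diff continuous_map_real_mult cd) auto
    from closedin_continuous_map_preimage[OF this, of "{0}"] show ?thesis by simp
  qed
  then have "closedin (mtopology_of (curves X)) (\<Inter>(s,t)\<in>{0..1}\<times>{0..1}. ?C s t)"
    by (intro closedin_INT) auto
  moreover have "(\<Inter>(s,t)\<in>{0..1}\<times>{0..1}. ?C s t) = Geo X"
  proof (rule set_eqI)
    fix \<gamma>
    have "(0::real) \<in> {0..1}" by simp
    have "\<gamma> \<in> (\<Inter>(s,t)\<in>{0..1}\<times>{0..1}. ?C s t) \<longleftrightarrow> (\<forall>s\<in>{0..1::real}. \<forall>t\<in>{0..1}. \<gamma> \<in> ?C s t)"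
      by auto
    also have "\<dots> \<longleftrightarrow> \<gamma> \<in> Geo X"
      using \<open>(0::real) \<in> {0..1}\<close> unfolding Geo_def mem_Collect_eq singleton_iff right_minus_eq by blast
    finally show "\<gamma> \<in> (\<Inter>(s,t)\<in>{0..1}\<times>{0..1}. ?C s t) \<longleftrightarrow> \<gamma> \<in> Geo X" .
  qed
  ultimately show ?thesis
    by (metis closedin_sets_borel_of_metric)
qed

section \<open>Bounds for the entropy\<close>

text \<open>The left side is the tangent at \<open>c\<close> of the convex function
  \<open>x * ln x\<close>. The tangent at 1 gives the lower bound -1; the tangent at the inverse of
  the mass of a support gives Jensen's inequality.\<close>

lemma mult_ln_ge_affine:
  fixes x c :: real
  assumes "0 \<le> x" "0 < c"
  shows "x * (1 + ln c) - c \<le> x * ln x"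
proof (cases "x = 0")
  case False
  then have "x > 0" using assms by simp
  have "ln (c / x) \<le> c / x - 1"
    using \<open>x > 0\<close> \<open>c > 0\<close> by (intro ln_le_minus_one) auto
  then have "x * (ln c - ln x) \<le> x * (c / x - 1)"
    using \<open>x > 0\<close> \<open>c > 0\<close> by (intro mult_left_mono) (auto simp: ln_div)
  then show ?thesis using \<open>x > 0\<close> by (simp add: algebra_simps)
qed (use assms in auto)

text \<open>Gives access to \<open>Ent\<close> through a real density. \<open>RN_deriv\<close> may
  be infinite on a null set, which \<open>enn2real\<close> sends to 0, so the masses of all
  measurable sets are preserved.\<close>

lemma Ent_real_density:
  assumes "finite_measure m" "prob_space \<nu>" "sets \<nu> = sets m" "absolutely_continuous m \<nu>"
  obtains \<rho> :: "'a \<Rightarrow> real" where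
    "\<rho> \<in> borel_measurable m" "\<And>x. 0 \<le> \<rho> x" "integrable m \<rho>" "integral\<^sup>L m \<rho> = 1"
    "\<And>A. A \<in> sets m \<Longrightarrow> (\<integral>x\<in>A. \<rho> x \<partial>m) = measure \<nu> A"
    "Ent m \<nu> = enn2ereal (\<integral>\<^sup>+ x. ennreal (\<rho> x * ln (\<rho> x)) \<partial>m)
       - enn2ereal (\<integral>\<^sup>+ x. ennreal (- (\<rho> x * ln (\<rho> x))) \<partial>m)"
proof -
  interpret finite_measure m by fact
  interpret N: prob_space \<nu> by fact
  define \<rho> where "\<rho> = (\<lambda>x. enn2real (RN_deriv m \<nu> x))"
  have \<rho>m [measurable]: "\<rho> \<in> borel_measurable m" by (simp add: \<rho>_def)
  have dens: "density m (RN_deriv m \<nu>) = \<nu>" using assms by (intro density_RN_deriv)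
  have fin: "AE x in m. RN_deriv m \<nu> x \<noteq> \<infinity>"
    using assms by (intro RN_deriv_finite) (auto intro: N.sigma_finite_measure_axioms)
  then have eq: "AE x in m. RN_deriv m \<nu> x = ennreal (\<rho> x)"
    by eventually_elim (auto simp: \<rho>_def less_top)
  have emeas: "emeasure \<nu> A = (\<integral>\<^sup>+x. ennreal (indicator A x * \<rho> x) \<partial>m)" if [measurable]: "A \<in> sets m" for A
  proof -
    have "emeasure \<nu> A = (\<integral>\<^sup>+x. RN_deriv m \<nu> x * indicator A x \<partial>m)"
      by (subst dens[symmetric]) (simp add: emeasure_density)
    also have "\<dots> = (\<integral>\<^sup>+x. ennreal (indicator A x * \<rho> x) \<partial>m)"
      using eq by (intro nn_integral_cong_AE) (auto split: split_indicator)
    finally show ?thesis .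
  qed
  have int: "has_bochner_integral m (\<lambda>x. indicator A x * \<rho> x) (measure \<nu> A)" if [measurable]: "A \<in> sets m" for A
    by (rule has_bochner_integral_nn_integral)
       (use emeas[OF that] in \<open>auto simp: \<rho>_def N.emeasure_eq_measure\<close>)
  have ex: "\<exists>\<rho>\<in>borel_measurable m. \<nu> = density m \<rho>"
    by (intro bexI[of _ "RN_deriv m \<nu>"]) (auto simp: dens)
  have sp: "space \<nu> = space m" using assms(3) by (rule sets_eq_imp_space_eq)
  have 1: "has_bochner_integral m \<rho> 1"
    using int[of "space m"] N.prob_space sp
    by (auto cong: has_bochner_integral_cong)
  show ?thesis
  proof
    show "integrable m \<rho>" "integral\<^sup>L m \<rho> = 1"
      using 1 by (auto simp: has_bochner_integral_iff)
    show "(\<integral>x\<in>A. \<rho> x \<partial>m) = measure \<nu> A" if "A \<in> sets m" for A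
      using int[OF that] by (auto simp: has_bochner_integral_iff set_lebesgue_integral_def)
    show "Ent m \<nu> = enn2ereal (\<integral>\<^sup>+ x. ennreal (\<rho> x * ln (\<rho> x)) \<partial>m)
       - enn2ereal (\<integral>\<^sup>+ x. ennreal (- (\<rho> x * ln (\<rho> x))) \<partial>m)"
      using ex by (simp add: Ent_def \<rho>_def)
  qed (auto simp: \<rho>_def)
qed

lemma enn2ereal_diff_eq_integral:
  fixes g :: "'a \<Rightarrow> real"
  assumes "integrable m g"
  shows "enn2ereal (\<integral>\<^sup>+ x. ennreal (g x) \<partial>m) - enn2ereal (\<integral>\<^sup>+ x. ennreal (- g x) \<partial>m)
    = ereal (integral\<^sup>L m g)"
proof -
  have "(\<integral>\<^sup>+ x. ennreal (g x) \<partial>m) \<noteq> \<infinity>" "(\<integral>\<^sup>+ x. ennreal (- g x) \<partial>m) \<noteq> \<infinity>"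
    using assms by (auto simp: real_integrable_def)
  then obtain a b where "(\<integral>\<^sup>+ x. ennreal (g x) \<partial>m) = ennreal a" "0 \<le> a"
      "(\<integral>\<^sup>+ x. ennreal (- g x) \<partial>m) = ennreal b" "0 \<le> b"
    by (metis ennreal_cases infinity_ennreal_def)
  then show ?thesis
    by (simp add: real_lebesgue_integral_def[OF assms] enn2ereal_ennreal)
qed

text \<open>Domination by \<open>c\<close> times \<open>m\<close> forces the density below
  \<open>c\<close> almost everywhere, so \<open>\<rho> * ln \<rho> \<le> \<rho> * ln c\<close>, and
  \<open>\<rho>\<close> has integral 1.\<close>

lemma Ent_le_ln:
  assumes "finite_measure m" "prob_space \<nu>" "sets \<nu> = sets m" "0 < c"
    and le: "\<And>A. A \<in> sets m \<Longrightarrow> emeasure \<nu> A \<le> ennreal c * emeasure m A"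
  shows "Ent m \<nu> \<le> ereal (ln c)"
proof -
  interpret finite_measure m by fact
  interpret N: prob_space \<nu> by fact
  have ac: "absolutely_continuous m \<nu>"
    using le by (force simp: absolutely_continuous_def null_sets_def assms(3))
  obtain \<rho> :: "'a \<Rightarrow> real" where \<rho>:
    "\<rho> \<in> borel_measurable m" "\<And>x. 0 \<le> \<rho> x" "integrable m \<rho>" "integral\<^sup>L m \<rho> = 1"
    "\<And>A. A \<in> sets m \<Longrightarrow> (\<integral>x\<in>A. \<rho> x \<partial>m) = measure \<nu> A"
    "Ent m \<nu> = enn2ereal (\<integral>\<^sup>+ x. ennreal (\<rho> x * ln (\<rho> x)) \<partial>m)
       - enn2ereal (\<integral>\<^sup>+ x. ennreal (- (\<rho> x * ln (\<rho> x))) \<partial>m)"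
    using Ent_real_density[OF assms(1-3) ac] by blast
  note [measurable] = \<rho>(1)
  \<comment> \<open>The inequality between measures becomes a pointwise one by testing
    \<open>c - \<rho>\<close> on all measurable sets.\<close>
  have "AE x in m. 0 \<le> c - \<rho> x"
  proof (rule density_nonneg)
    show "integrable m (\<lambda>x. c - \<rho> x)" using \<rho>(3) by simp
    fix A assume A: "A \<in> sets m"
    have "(\<integral>x\<in>A. c - \<rho> x \<partial>m) = (\<integral>x\<in>A. c \<partial>m) - (\<integral>x\<in>A. \<rho> x \<partial>m)"
      using integrable_mult_indicator[OF A \<rho>(3)] integrable_mult_indicator[OF A integrable_const[of c]]
      by (intro set_integral_diff) (auto simp: set_integrable_def)
    also have "\<dots> = c * measure m A - measure \<nu> A"
      using A \<rho>(5) by (simp add: set_lebesgue_integral_def)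
    also have "\<dots> \<ge> 0"
      using le[OF A] \<open>0 < c\<close>
      by (simp add: emeasure_eq_measure N.emeasure_eq_measure ennreal_le_iff flip: ennreal_mult)
    finally show "(\<integral>x\<in>A. c - \<rho> x \<partial>m) \<ge> 0" .
  qed
  then have AE: "AE x in m. \<rho> x \<le> c" by simp
  have pt: "x * ln x \<le> x * ln c" if "0 \<le> x" "x \<le> c" for x :: real
    using that \<open>0 < c\<close> by (cases "x = 0") (auto intro!: mult_left_mono)
  \<comment> \<open>Boundedness of the integrand on a finite measure space turns the difference of
    positive and negative part in \<open>Ent\<close> into one real integral.\<close>
  have int: "integrable m (\<lambda>x. \<rho> x * ln (\<rho> x))"
  proof (rule integrable_const_bound)
    show "AE x in m. norm (\<rho> x * ln (\<rho> x)) \<le> 1 + c * \<bar>ln c\<bar>"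
      using AE
    proof eventually_elim
      fix x assume x: "\<rho> x \<le> c"
      have "\<rho> x * ln (\<rho> x) \<le> \<rho> x * ln c" using pt \<rho>(2) x by blast
      also have "\<dots> \<le> \<rho> x * \<bar>ln c\<bar>" using \<rho>(2)[of x] by (intro mult_left_mono) auto
      also have "\<dots> \<le> c * \<bar>ln c\<bar>" using x by (intro mult_right_mono) auto
      finally have "\<rho> x * ln (\<rho> x) \<le> c * \<bar>ln c\<bar>" .
      moreover have "- 1 \<le> \<rho> x * ln (\<rho> x)"
        using mult_ln_ge_affine[of "\<rho> x" 1] \<rho>(2)[of x] by simp
      moreover have "0 \<le> c * \<bar>ln c\<bar>" using \<open>0 < c\<close> by simp
      ultimately show "norm (\<rho> x * ln (\<rho> x)) \<le> 1 + c * \<bar>ln c\<bar>"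
        by (simp only: real_norm_def abs_le_iff) linarith
    qed
  qed simp
  have "Ent m \<nu> = ereal (\<integral>x. \<rho> x * ln (\<rho> x) \<partial>m)"
    using enn2ereal_diff_eq_integral[OF int] \<rho>(6) by simp
  also have "(\<integral>x. \<rho> x * ln (\<rho> x) \<partial>m) \<le> (\<integral>x. \<rho> x * ln c \<partial>m)"
    using AE pt \<rho>(2,3) int by (intro integral_mono_AE) auto
  also have "\<dots> = ln c" using \<rho>(4) by simp
  finally show ?thesis by simp
qed

text \<open>Jensen's inequality: among probability measures carried by a set of mass at most
  \<open>\<sigma>\<close>, entropy is at least that of a constant density \<open>1/\<sigma>\<close>.
  It is proved by integrating the tangent of \<open>x * ln x\<close> at \<open>1/\<sigma>\<close>
  over \<open>S\<close>.\<close>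

lemma Ent_ge_minus_ln:
  assumes "finite_measure m" "prob_space \<nu>" "sets \<nu> = sets m"
    and S: "S \<in> sets m" "AE x in \<nu>. x \<in> S" "emeasure m S \<le> ennreal \<sigma>" "0 < \<sigma>"
  shows "ereal (- ln \<sigma>) \<le> Ent m \<nu>"
proof (cases "\<exists>\<rho>\<in>borel_measurable m. \<nu> = density m \<rho>")
  case True
  interpret finite_measure m by fact
  interpret N: prob_space \<nu> by fact
  have ac: "absolutely_continuous m \<nu>"
    using True by (auto intro: absolutely_continuousI_density)
  obtain \<rho> :: "'a \<Rightarrow> real" where \<rho>:
    "\<rho> \<in> borel_measurable m" "\<And>x. 0 \<le> \<rho> x" "integrable m \<rho>" "integral\<^sup>L m \<rho> = 1"
    "\<And>A. A \<in> sets m \<Longrightarrow> (\<integral>x\<in>A. \<rho> x \<partial>m) = measure \<nu> A"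
    "Ent m \<nu> = enn2ereal (\<integral>\<^sup>+ x. ennreal (\<rho> x * ln (\<rho> x)) \<partial>m)
       - enn2ereal (\<integral>\<^sup>+ x. ennreal (- (\<rho> x * ln (\<rho> x))) \<partial>m)"
    using Ent_real_density[OF assms(1-3) ac] by blast
  note [measurable] = \<rho>(1) S(1)
  define g where "g = (\<lambda>x. \<rho> x * ln (\<rho> x))"
  have [measurable]: "g \<in> borel_measurable m" by (simp add: g_def)
  have S': "S \<in> sets \<nu>" using S(1) assms(3) by simp
  have "measure \<nu> S = 1" using S(2) S' N.prob_eq_1 by simp
  then have \<rho>S: "(\<integral>x. indicator S x * \<rho> x \<partial>m) = 1"
    using \<rho>(5)[OF S(1)] by (simp add: set_lebesgue_integral_def)
  have \<rho>Si: "integrable m (\<lambda>x. indicator S x * \<rho> x)"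
    using integrable_mult_indicator[OF S(1) \<rho>(3)] by simp
  \<comment> \<open>As \<open>g \<ge> -1\<close> and \<open>m\<close> is finite, the negative part
    is always finite; failure of integrability can then only mean that the entropy is
    infinite.\<close>
  have neg: "(\<integral>\<^sup>+ x. ennreal (- g x) \<partial>m) < \<infinity>"
  proof -
    have "(\<integral>\<^sup>+ x. ennreal (- g x) \<partial>m) \<le> (\<integral>\<^sup>+ x. 1 \<partial>m)"
    proof (rule nn_integral_mono)
      fix x
      have "- g x \<le> 1" using mult_ln_ge_affine[of "\<rho> x" 1] \<rho>(2)[of x] by (simp add: g_def)
      then show "ennreal (- g x) \<le> 1" by (simp add: ennreal_le_1)
    qed
    also have "\<dots> < \<infinity>" by (simp add: less_top[symmetric])
    finally show ?thesis .
  qed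
  show ?thesis
  proof (cases "integrable m g")
    case int: True
    \<comment> \<open>Outside \<open>S\<close> the tangent would contribute its constant term
      \<open>- 1/\<sigma>\<close> on all of the space; knowing that the density vanishes there
      allows this term to be restricted to \<open>S\<close>.\<close>
    have ae0: "AE x in m. \<rho> x - indicator S x * \<rho> x = 0"
    proof (subst integral_nonneg_eq_0_iff_AE[symmetric])
      show "(\<integral>x. \<rho> x - indicator S x * \<rho> x \<partial>m) = 0"
        using \<rho>(3,4) \<rho>S \<rho>Si by simp
    qed (use \<rho>(2,3) \<rho>Si in \<open>auto split: split_indicator\<close>)
    have "measure m S \<le> \<sigma>" using S by (simp add: emeasure_eq_measure)
    then have "- ln \<sigma> \<le> (1 + ln (1/\<sigma>)) * 1 - (1/\<sigma>) * measure m S"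
      using \<open>0 < \<sigma>\<close> by (simp add: ln_div)
    also have "\<dots> = (\<integral>x. (1 + ln (1/\<sigma>)) * \<rho> x - (1/\<sigma>) * indicator S x \<partial>m)"
      using \<rho>(3,4) integrable_mult_indicator[OF S(1) integrable_const[of "1::real"]]
      by (subst Bochner_Integration.integral_diff) auto
    also have "\<dots> \<le> (\<integral>x. g x \<partial>m)"
    proof (rule integral_mono_AE)
      show "AE x in m. (1 + ln (1/\<sigma>)) * \<rho> x - (1/\<sigma>) * indicator S x \<le> g x"
        using ae0
      proof eventually_elim
        fix x assume x: "\<rho> x - indicator S x * \<rho> x = 0"
        show "(1 + ln (1/\<sigma>)) * \<rho> x - (1/\<sigma>) * indicator S x \<le> g x"
        proof (cases "x \<in> S")
          case True
          then show ?thesis using mult_ln_ge_affine[of "\<rho> x" "1/\<sigma>"] \<rho>(2)[of x] \<open>0 < \<sigma>\<close>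
            by (simp add: g_def mult.commute)
        next
          case False
          then have "\<rho> x = 0" using x by simp
          then show ?thesis using False by (simp add: g_def)
        qed
      qed
    qed (use int \<rho>(3) integrable_mult_indicator[OF S(1) integrable_const[of "1::real"]] in auto)
    finally show ?thesis
      using enn2ereal_diff_eq_integral[OF int] \<rho>(6) by (simp add: g_def)
  next
    case False
    then have "(\<integral>\<^sup>+ x. ennreal (g x) \<partial>m) = \<infinity>"
      using neg by (auto simp: real_integrable_def)
    then have "Ent m \<nu> = \<infinity>"
      using \<rho>(6) neg by (simp add: g_def enn2ereal_top minus_ereal_def)
    then show ?thesis by simp
  qed
qed (simp add: Ent_def)

section \<open>Conditional selection of curves\<close>

text \<open>\<open>p\<close> is the conditional probability of \<open>B\<close> given the value of
  \<open>e\<close>. It is the Radon-Nikodym derivative of the image of \<open>M\<close> restricted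
  to \<open>B\<close>, so no disintegration of \<open>M\<close> is required; testing against all
  \<open>g\<close> is the form in which it is applied.\<close>

lemma conditional_probability_density:
  assumes "prob_space M" and e [measurable]: "e \<in> M \<rightarrow>\<^sub>M N" and B [measurable]: "B \<in> sets M"
  obtains p :: "'b \<Rightarrow> real" where "p \<in> borel_measurable N" "\<forall>y. 0 \<le> p y"
    "\<forall>g\<in>borel_measurable N.
      (\<integral>\<^sup>+x. indicator B x * g (e x) \<partial>M) = (\<integral>\<^sup>+y. ennreal (p y) * g y \<partial>distr M N e)"
proof -
  interpret prob_space M by fact
  interpret \<mu>: prob_space "distr M N e" by (rule prob_space_distr) fact
  define \<alpha> where "\<alpha> = distr (density M (indicator B)) N e"
  have \<alpha>: "emeasure \<alpha> C = emeasure M (B \<inter> (e -` C \<inter> space M))" if [measurable]: "C \<in> sets N" for C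
  proof -
    have "emeasure \<alpha> C = (\<integral>\<^sup>+x. indicator B x * indicator (e -` C \<inter> space M) x \<partial>M)"
      unfolding \<alpha>_def by (simp add: emeasure_distr emeasure_density)
    also have "\<dots> = (\<integral>\<^sup>+x. indicator (B \<inter> (e -` C \<inter> space M)) x \<partial>M)"
      by (intro nn_integral_cong) (simp add: indicator_inter_arith)
    also have "\<dots> = emeasure M (B \<inter> (e -` C \<inter> space M))"
      by (rule nn_integral_indicator) measurable
    finally show ?thesis .
  qed
  have "finite_measure \<alpha>"
  proof (rule finite_measureI)
    have "space \<alpha> = space N" by (simp add: \<alpha>_def)
    then show "emeasure \<alpha> (space \<alpha>) \<noteq> \<infinity>"
      using \<alpha>[OF sets.top] by simp
  qed
  moreover have "absolutely_continuous (distr M N e) \<alpha>"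
  proof -
    have "C \<in> null_sets \<alpha>" if "C \<in> null_sets (distr M N e)" for C
    proof -
      have C: "C \<in> sets N" using that by (simp add: null_sets_def)
      have "emeasure M (e -` C \<inter> space M) = 0"
        using that emeasure_distr[OF e C] by (simp add: null_sets_def)
      then have "emeasure M (B \<inter> (e -` C \<inter> space M)) = 0"
        by (rule emeasure_eq_0[OF measurable_sets[OF e C] _ Int_lower2])
      moreover have "C \<in> sets \<alpha>" using C by (simp add: \<alpha>_def)
      ultimately show ?thesis using \<alpha>[OF C] by (simp add: null_sets_def)
    qed
    then show ?thesis unfolding absolutely_continuous_def by blast
  qed
  moreover have "sets \<alpha> = sets (distr M N e)" by (simp add: \<alpha>_def)
  ultimately have ac: "finite_measure \<alpha>" "absolutely_continuous (distr M N e) \<alpha>"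
      "sets \<alpha> = sets (distr M N e)" by auto
  obtain p where p: "p \<in> borel_measurable (distr M N e)"
    "AE y in distr M N e. RN_deriv (distr M N e) \<alpha> y = ennreal (p y)"
    "AE y in \<alpha>. 0 < p y" "\<And>y. 0 \<le> p y"
    by (rule \<mu>.real_RN_deriv[OF ac]) blast
  have [measurable]: "p \<in> borel_measurable N" using p(1) by simp
  have dens: "density (distr M N e) (\<lambda>y. ennreal (p y)) = \<alpha>"
  proof -
    have "density (distr M N e) (RN_deriv (distr M N e) \<alpha>) = density (distr M N e) (\<lambda>y. ennreal (p y))"
      using p(2) by (intro density_cong) auto
    then show ?thesis using \<mu>.density_RN_deriv[OF ac(2,3)] by simp
  qed
  show ?thesis
  proof (rule that[of p], goal_cases)
    case 3
    show ?case
    proof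
      fix g :: "'b \<Rightarrow> ennreal" assume [measurable]: "g \<in> borel_measurable N"
      have "(\<integral>\<^sup>+x. indicator B x * g (e x) \<partial>M) = (\<integral>\<^sup>+y. g y \<partial>\<alpha>)"
        unfolding \<alpha>_def by (simp add: nn_integral_distr nn_integral_density)
      also have "\<dots> = (\<integral>\<^sup>+y. ennreal (p y) * g y \<partial>distr M N e)"
        unfolding dens[symmetric] by (subst nn_integral_density) auto
      finally show "(\<integral>\<^sup>+x. indicator B x * g (e x) \<partial>M) = (\<integral>\<^sup>+y. ennreal (p y) * g y \<partial>distr M N e)" .
    qed
  qed (use p in auto)
qed

text \<open>For each value of \<open>e\<close>, either \<open>A\<close> or its complement has
  conditional probability at least 1/2. Keeping only that event and dividing by its probability
  gives a weight with conditional expectation 1, hence the same image under \<open>e\<close>, and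
  bounded by 2. \<open>D\<close> records the values at which \<open>A\<close> is kept.\<close>

lemma selecting_weight:
  assumes "prob_space M" and e [measurable]: "e \<in> M \<rightarrow>\<^sub>M N" and A [measurable]: "A \<in> sets M"
  obtains F :: "'a \<Rightarrow> real" and D where
    "F \<in> borel_measurable M" "\<And>x. 0 \<le> F x" "\<And>x. F x \<le> 2" "D \<in> sets N"
    "\<And>x. x \<in> space M \<Longrightarrow> F x \<noteq> 0 \<Longrightarrow> e x \<in> D \<longleftrightarrow> x \<in> A"
    "distr (density M F) N e = distr M N e"
proof -
  interpret prob_space M by fact
  interpret \<mu>: prob_space "distr M N e" by (rule prob_space_distr) fact
  have A' [measurable]: "space M - A \<in> sets M" by simp
  obtain p where p [measurable]: "p \<in> borel_measurable N" and p0: "\<forall>y. 0 \<le> p y"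
    and pg: "\<forall>g\<in>borel_measurable N.
      (\<integral>\<^sup>+x. indicator (A) x * g (e x) \<partial>M) = (\<integral>\<^sup>+y. ennreal (p y) * g y \<partial>distr M N e)"
    by (rule conditional_probability_density[OF assms(1,2) A])
  obtain q where q [measurable]: "q \<in> borel_measurable N" and q0: "\<forall>y. 0 \<le> q y"
    and qg: "\<forall>g\<in>borel_measurable N.
      (\<integral>\<^sup>+x. indicator (space M - A) x * g (e x) \<partial>M) = (\<integral>\<^sup>+y. ennreal (q y) * g y \<partial>distr M N e)"
    by (rule conditional_probability_density[OF assms(1,2) A'])
  \<comment> \<open>The two conditional probabilities add up to 1 because both sides are densities
    of the same image measure.\<close>
  have "AE y in distr M N e. ennreal (p y) + ennreal (q y) = 1"
  proof (rule \<mu>.density_unique_finite_measure)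
    fix C assume "C \<in> sets (distr M N e)"
    then have [measurable]: "C \<in> sets N" by simp
    have "(\<integral>\<^sup>+y. (ennreal (p y) + ennreal (q y)) * indicator C y \<partial>distr M N e)
      = (\<integral>\<^sup>+y. ennreal (p y) * indicator C y \<partial>distr M N e) + (\<integral>\<^sup>+y. ennreal (q y) * indicator C y \<partial>distr M N e)"
      unfolding distrib_right by (rule nn_integral_add) auto
    also have "\<dots> = (\<integral>\<^sup>+x. indicator A x * indicator C (e x) \<partial>M)
        + (\<integral>\<^sup>+x. indicator (space M - A) x * indicator C (e x) \<partial>M)"
      by (simp add: pg qg)
    also have "\<dots> = (\<integral>\<^sup>+x. indicator A x * indicator C (e x)
        + indicator (space M - A) x * indicator C (e x) \<partial>M)"
      by (rule nn_integral_add[symmetric]) auto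
    also have "\<dots> = (\<integral>\<^sup>+x. 1 * indicator C (e x) \<partial>M)"
      by (rule nn_integral_cong) (auto split: split_indicator)
    also have "\<dots> = (\<integral>\<^sup>+y. 1 * indicator C y \<partial>distr M N e)"
      by (subst nn_integral_distr) auto
    finally show "(\<integral>\<^sup>+y. (ennreal (p y) + ennreal (q y)) * indicator C y \<partial>distr M N e)
      = (\<integral>\<^sup>+y. 1 * indicator C y \<partial>distr M N e)" .
  qed auto
  then have pq: "AE y in distr M N e. p y + q y = 1"
    by eventually_elim (use p0 q0 in \<open>simp flip: ennreal_plus ennreal_1\<close>)
  \<comment> \<open>Ties are decided in favour of \<open>A\<close>. The last alternative, where both
    probabilities are below 1/2, is met only over a null set.\<close>
  define F where "F = (\<lambda>x. if 1/2 \<le> p (e x) then indicator A x / p (e x)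
    else if 1/2 \<le> q (e x) then indicator (space M - A) x / q (e x) else 0)"
  have [measurable]: "F \<in> borel_measurable M" unfolding F_def by measurable
  show ?thesis
  proof
    show "{y \<in> space N. 1/2 \<le> p y} \<in> sets N" by measurable
    show "F \<in> borel_measurable M" by measurable
    show "0 \<le> F x" for x using p0 q0 by (simp add: F_def)
    show "F x \<le> 2" for x by (auto simp: F_def field_simps split: split_indicator)
    show "e x \<in> {y \<in> space N. 1/2 \<le> p y} \<longleftrightarrow> x \<in> A" if "x \<in> space M" "F x \<noteq> 0" for x
      using that measurable_space[OF e] by (auto simp: F_def split: if_splits split_indicator_asm)
    show "distr (density M F) N e = distr M N e"
    proof (rule measure_eqI)
      fix C assume "C \<in> sets (distr (density M F) N e)"
      then have [measurable]: "C \<in> sets N" by simp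
      \<comment> \<open>\<open>g1\<close> and \<open>g2\<close> are the factors of the weight that
        depend on \<open>e\<close> alone, already cut off to \<open>C\<close>; after conditioning,
        \<open>p * g1 + q * g2\<close> is the indicator of \<open>C\<close> almost
        everywhere.\<close>
      define g1 where "g1 y = (if 1/2 \<le> p y then ennreal (1 / p y) * indicator C y else 0)" for y
      define g2 where "g2 y = (if 1/2 \<le> p y then 0 else if 1/2 \<le> q y then ennreal (1 / q y) * indicator C y else 0)" for y
      have [measurable]: "g1 \<in> borel_measurable N" "g2 \<in> borel_measurable N"
        unfolding g1_def g2_def by measurable
      have "emeasure (distr (density M F) N e) C = (\<integral>\<^sup>+x. ennreal (F x) * indicator C (e x) \<partial>M)"
        by (subst emeasure_distr)
           (auto simp: emeasure_density intro!: nn_integral_cong split: split_indicator)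
      also have "\<dots> = (\<integral>\<^sup>+x. indicator A x * g1 (e x) + indicator (space M - A) x * g2 (e x) \<partial>M)"
        by (rule nn_integral_cong) (auto simp: F_def g1_def g2_def split: split_indicator)
      also have "\<dots> = (\<integral>\<^sup>+x. indicator A x * g1 (e x) \<partial>M) + (\<integral>\<^sup>+x. indicator (space M - A) x * g2 (e x) \<partial>M)"
        by (rule nn_integral_add) auto
      also have "\<dots> = (\<integral>\<^sup>+y. ennreal (p y) * g1 y \<partial>distr M N e) + (\<integral>\<^sup>+y. ennreal (q y) * g2 y \<partial>distr M N e)"
        by (simp add: pg qg)
      also have "\<dots> = (\<integral>\<^sup>+y. ennreal (p y) * g1 y + ennreal (q y) * g2 y \<partial>distr M N e)"
        by (rule nn_integral_add[symmetric]) auto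
      also have "\<dots> = (\<integral>\<^sup>+y. indicator C y \<partial>distr M N e)"
        using pq by (intro nn_integral_cong_AE, eventually_elim)
          (auto simp: g1_def g2_def simp flip: mult.assoc ennreal_mult')
      finally show "emeasure (distr (density M F) N e) C = emeasure (distr M N e) C"
        by simp
    qed simp
  qed
qed

section \<open>Hausdorff measure of horizontal sets\<close>

lemma countable_disjoint_enumeration:
  assumes "countable P" "disjoint P"
  obtains E :: "nat \<Rightarrow> 'a set" where "disjoint_family E" "range E \<subseteq> insert {} P" "(\<Union>n. E n) = \<Union>P"
proof
  define E where "E n = (if n \<in> to_nat_on P ` P then from_nat_into P n else {})" for n
  have E: "E (to_nat_on P S) = S" if "S \<in> P" for S
    using that assms(1) by (simp add: E_def)
  show "disjoint_family E"
    unfolding disjoint_family_on_def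
  proof (intro ballI impI)
    fix m n :: nat assume "m \<noteq> n"
    show "E m \<inter> E n = {}"
    proof (cases "m \<in> to_nat_on P ` P \<and> n \<in> to_nat_on P ` P")
      case True
      then obtain S T where "S \<in> P" "T \<in> P" "m = to_nat_on P S" "n = to_nat_on P T" by auto
      moreover have "S \<noteq> T" using calculation \<open>m \<noteq> n\<close> by auto
      ultimately show ?thesis using E assms(2) by (simp add: disjoint_def)
    qed (auto simp: E_def)
  qed
  show "range E \<subseteq> insert {} P"
    using E by (auto simp: E_def)
  show "(\<Union>n. E n) = \<Union>P"
  proof
    show "(\<Union>n. E n) \<subseteq> \<Union>P" using E by (fastforce simp: E_def split: if_splits)
    show "\<Union>P \<subseteq> (\<Union>n. E n)" using E by blast
  qed
qed

text \<open>Supplies efficient covers for the Hausdorff measure: the components of \<open>U\<close>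
  are cut along a grid of mesh \<open>\<delta>\<close>. The cells are half-open so that the pieces
  form a partition and their lengths add up exactly.\<close>

lemma open_short_intervals:
  fixes U :: "real set"
  assumes "open U" "0 < \<delta>"
  obtains E :: "nat \<Rightarrow> real set" where "disjoint_family E" "(\<Union>n. E n) = U"
    "\<forall>n. is_interval (E n)" "\<forall>n. E n \<in> sets borel" "\<forall>n. \<forall>x\<in>E n. \<forall>y\<in>E n. \<bar>x - y\<bar> \<le> \<delta>"
proof -
  define G where "G j = {of_int j * \<delta> ..< (of_int j + 1) * \<delta>}" for j :: int
  have G: "x \<in> G j \<longleftrightarrow> \<lfloor>x / \<delta>\<rfloor> = j" for x j
    using \<open>0 < \<delta>\<close> by (auto simp: G_def floor_eq_iff field_simps)
  define P where "P = (\<lambda>(K, j). K \<inter> G j) ` (components U \<times> UNIV)"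
  have "countable (components U)"
    using assms(1) open_components components_nonoverlap
    by (intro countable_disjoint_open_subsets) (auto simp: pairwise_def disjnt_def, blast+)
  then have "countable P" by (auto simp: P_def)
  moreover have "disjoint P"
    unfolding disjoint_def
  proof (intro ballI impI)
    fix S T assume "S \<in> P" "T \<in> P" "S \<noteq> T"
    then obtain K j K' j' where S: "S = K \<inter> G j" "T = K' \<inter> G j'" "K \<in> components U" "K' \<in> components U"
      by (auto simp: P_def)
    show "S \<inter> T = {}"
    proof (rule ccontr)
      assume "S \<inter> T \<noteq> {}"
      then obtain x where "x \<in> K" "x \<in> K'" "x \<in> G j" "x \<in> G j'" using S by auto
      then have "K = K'" "j = j'" using S components_eq[of K U K'] G by auto
      then show False using S \<open>S \<noteq> T\<close> by simp
    qed
  qed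
  ultimately obtain E :: "nat \<Rightarrow> real set" where E: "disjoint_family E" "range E \<subseteq> insert {} P" "(\<Union>n. E n) = \<Union>P"
    by (rule countable_disjoint_enumeration)
  have mem: "E n = {} \<or> (\<exists>K j. K \<in> components U \<and> E n = K \<inter> G j)" for n
  proof -
    have "E n \<in> insert {} P" using E(2) by blast
    then show ?thesis by (auto simp: P_def)
  qed
  show ?thesis
  proof
    show "disjoint_family E" by fact
    have "\<Union>P = U"
    proof
      show "\<Union>P \<subseteq> U" using in_components_subset by (fastforce simp: P_def)
      show "U \<subseteq> \<Union>P"
      proof
        fix x assume "x \<in> U"
        then obtain K where "K \<in> components U" "x \<in> K" using Union_components by blast
        then show "x \<in> \<Union>P" using G by (force simp: P_def)
      qed
    qed
    then show "(\<Union>n. E n) = U" using E(3) by simp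
    show "\<forall>n. is_interval (E n)"
    proof
      fix n
      have "is_interval K" if "K \<in> components U" for K
        using that in_components_connected is_interval_connected_1 by blast
      then show "is_interval (E n)"
        using mem[of n] by (auto simp: G_def intro!: is_interval_Int is_interval_co)
    qed
    have "E n \<in> sets borel" for n
      using mem[of n] assms(1) by (auto simp: G_def dest: open_components)
    then show "\<forall>n. E n \<in> sets borel" by blast
    have "\<bar>x - y\<bar> \<le> \<delta>" if "x \<in> E n" "y \<in> E n" for n x y
      using mem[of n] that by (auto simp: G_def algebra_simps)
    then show "\<forall>n. \<forall>x\<in>E n. \<forall>y\<in>E n. \<bar>x - y\<bar> \<le> \<delta>" by blast
  qed
qed

lemma ediam_le: "(\<And>x y. x \<in> S \<Longrightarrow> y \<in> S \<Longrightarrow> ennreal (mdist X x y) \<le> d) \<Longrightarrow> ediam X S \<le> d"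
  unfolding ediam_def by (intro SUP_least)

lemma mdist_le_ediam: "x \<in> S \<Longrightarrow> y \<in> S \<Longrightarrow> ennreal (mdist X x y) \<le> ediam X S"
  unfolding ediam_def by (rule SUP_upper2, assumption, rule SUP_upper)

text \<open>Outer regularity of Lebesgue measure gives an open set of nearly the same length, and
  its partition into short intervals is a cover admissible at scale \<open>\<delta>\<close>.\<close>

lemma hausdorff1_horizontal_le:
  assumes A: "A \<subseteq> subgraph f" "\<And>p. p \<in> A \<Longrightarrow> snd p = 0"
    and B: "{x. (x, 0) \<in> A} \<in> sets borel"
  shows "hausdorff1 (subgraph_space f) A \<le> emeasure lborel {x. (x, 0) \<in> A}" (is "_ \<le> emeasure lborel ?B")
  unfolding hausdorff1_def
proof (rule SUP_least)
  fix \<delta> :: real assume "\<delta> \<in> {0<..}"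
  then have "0 < \<delta>" by simp
  show "hausdorff1_pre (subgraph_space f) \<delta> A \<le> emeasure lborel ?B"
  proof (rule ennreal_le_epsilon)
    fix e :: real assume "0 < e"
    obtain U where U: "open U" "?B \<subseteq> U" "emeasure lborel (U - ?B) < ennreal e"
      using outer_regular_lborel[OF B \<open>0 < e\<close>] by blast
    obtain E :: "nat \<Rightarrow> real set" where E: "disjoint_family E" "(\<Union>n. E n) = U" "\<forall>n. is_interval (E n)"
        "\<forall>n. E n \<in> sets borel" "\<forall>n. \<forall>x\<in>E n. \<forall>y\<in>E n. \<bar>x - y\<bar> \<le> \<delta>"
      by (rule open_short_intervals[OF U(1) \<open>0 < \<delta>\<close>])
    \<comment> \<open>The pieces are cut back to \<open>A\<close>: covering sets must lie in the
      space, and on \<open>A\<close> the distance reduces to the difference of first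
      coordinates.\<close>
    define E' where "E' n = A \<inter> fst -` E n" for n
    have d: "d_inf p q = \<bar>fst p - fst q\<bar>" if "p \<in> A" "q \<in> A" for p q
      using A(2) that by (simp add: d_inf_def)
    have "A \<subseteq> (\<Union>n. E' n)"
    proof
      fix p assume "p \<in> A"
      then have "(fst p, 0) \<in> A" using A(2)[of p] by (metis prod.collapse)
      then have "fst p \<in> U" using U(2) by auto
      then show "p \<in> (\<Union>n. E' n)" using \<open>p \<in> A\<close> E(2) by (auto simp: E'_def)
    qed
    moreover have "E' n \<subseteq> subgraph f" for n using A by (auto simp: E'_def)
    moreover have "ediam (subgraph_space f) (E' n) \<le> ennreal \<delta>" for n
      by (rule ediam_le) (use d E(5) in \<open>auto simp: E'_def intro!: ennreal_leI\<close>)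
    ultimately have "hausdorff1_pre (subgraph_space f) \<delta> A \<le> (\<Sum>n. ediam (subgraph_space f) (E' n))"
      unfolding hausdorff1_pre_def mspace_subgraph_space
      by (intro INF_lower[of E' _ "\<lambda>E. \<Sum>n. ediam (subgraph_space f) (E n)"] CollectI conjI allI)
    also have "\<dots> \<le> (\<Sum>n. emeasure lborel (E n))"
    proof (intro suminf_le ediam_le)
      fix n p q assume pq: "p \<in> E' n" "q \<in> E' n"
      \<comment> \<open>Convexity of the piece is what bounds its diameter by its length: it
        contains the segment between any two of its points.\<close>
      have le: "ennreal (b - a) \<le> emeasure lborel (E n)" if "a \<in> E n" "b \<in> E n" "a \<le> b" for a b
      proof -
        have "{a..b} \<subseteq> E n" using E(3) that unfolding is_interval_1 by (meson atLeastAtMost_iff subsetI)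
        then show ?thesis
          using emeasure_mono[of "{a..b}" "E n" lborel] E(4) that(3) by simp
      qed
      show "ennreal (mdist (subgraph_space f) p q) \<le> emeasure lborel (E n)"
        using le[of "fst p" "fst q"] le[of "fst q" "fst p"] pq d[of p q]
        by (cases "fst p \<le> fst q") (auto simp: E'_def)
    qed auto
    also have "\<dots> = emeasure lborel U"
      using suminf_emeasure[of E lborel] E by auto
    also have "\<dots> = emeasure lborel (?B \<union> (U - ?B))"
      using U(2) by (simp add: Un_absorb1)
    also have "\<dots> \<le> emeasure lborel ?B + emeasure lborel (U - ?B)"
      using B U(1) by (intro emeasure_subadditive) auto
    also have "\<dots> \<le> emeasure lborel ?B + ennreal e"
      using U(3) by (intro add_left_mono) simp
    finally show "hausdorff1_pre (subgraph_space f) \<delta> A \<le> emeasure lborel ?B + ennreal e" .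
  qed
qed

text \<open>Projection to the first coordinate is 1-Lipschitz, so every covering set projects into
  an interval as long as its diameter. The single scale 1 suffices because the Hausdorff measure is
  a supremum over scales.\<close>

lemma hausdorff1_horizontal_ge:
  assumes B: "{x. (x, 0) \<in> A} \<in> sets borel"
  shows "emeasure lborel {x. (x, 0) \<in> A} \<le> hausdorff1 (subgraph_space f) A" (is "emeasure lborel ?B \<le> _")
proof -
  have "emeasure lborel ?B \<le> hausdorff1_pre (subgraph_space f) 1 A"
    unfolding hausdorff1_pre_def
  proof (rule INF_greatest)
    fix E :: "nat \<Rightarrow> (real \<times> real) set"
    assume "E \<in> {E. A \<subseteq> (\<Union>i. E i) \<and> (\<forall>i. E i \<subseteq> mspace (subgraph_space f)
        \<and> ediam (subgraph_space f) (E i) \<le> ennreal 1)}"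
    then have E: "A \<subseteq> (\<Union>i. E i)" "\<And>i. ediam (subgraph_space f) (E i) \<le> 1" by auto
    have "\<exists>J\<in>sets borel. fst ` E i \<subseteq> J \<and> emeasure lborel J \<le> ediam (subgraph_space f) (E i)" for i
    proof (cases "E i = {}")
      case True
      then show ?thesis by (intro bexI[of _ "{}"]) auto
    next
      case False
      \<comment> \<open>The scale bound makes the diameter finite, so it is a real number and can
        serve as the length of an interval starting at the infimum of the projection.\<close>
      define r where "r = enn2real (ediam (subgraph_space f) (E i))"
      have r: "ediam (subgraph_space f) (E i) = ennreal r" "0 \<le> r"
        using le_less_trans[OF E(2)[of i] ennreal_one_less_top] by (auto simp: r_def)
      have dist: "\<bar>x - y\<bar> \<le> r" if "x \<in> fst ` E i" "y \<in> fst ` E i" for x y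
      proof -
        obtain p q where "p \<in> E i" "q \<in> E i" "x = fst p" "y = fst q" using \<open>x \<in> _\<close> \<open>y \<in> _\<close> by auto
        then show ?thesis
          using mdist_le_ediam[of p "E i" q "subgraph_space f"] r by (simp add: d_inf_def)
      qed
      obtain y where y: "y \<in> fst ` E i" using False by auto
      have bdd: "bdd_below (fst ` E i)"
        by (rule bdd_belowI[of _ "y - r"]) (use dist[OF y] in force)
      define a where "a = Inf (fst ` E i)"
      have "fst ` E i \<subseteq> {a..a + r}"
      proof
        fix x assume x: "x \<in> fst ` E i"
        have "x - r \<le> a" unfolding a_def
          using y dist[OF x] by (intro cInf_greatest) (auto, smt (verit) fst_conv image_eqI)
        moreover have "a \<le> x" unfolding a_def by (rule cInf_lower[OF x bdd])
        ultimately show "x \<in> {a..a + r}" by simp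
      qed
      then show ?thesis using r by (intro bexI[of _ "{a..a + r}"]) auto
    qed
    then obtain J where J: "\<And>i. J i \<in> sets borel" "\<And>i. fst ` E i \<subseteq> J i"
        "\<And>i. emeasure lborel (J i) \<le> ediam (subgraph_space f) (E i)"
      by metis
    have "?B \<subseteq> (\<Union>i. J i)" using E(1) J(2) by force
    then have "emeasure lborel ?B \<le> emeasure lborel (\<Union>i. J i)"
      using J(1) by (intro emeasure_mono) auto
    also have "\<dots> \<le> (\<Sum>i. emeasure lborel (J i))"
      using J(1) by (intro emeasure_subadditive_countably) auto
    also have "\<dots> \<le> (\<Sum>i. ediam (subgraph_space f) (E i))"
      using J(3) by (intro suminf_le) auto
    finally show "emeasure lborel ?B \<le> (\<Sum>i. ediam (subgraph_space f) (E i))" .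
  qed
  also have "\<dots> \<le> hausdorff1 (subgraph_space f) A"
    unfolding hausdorff1_def by (rule SUP_upper) simp
  finally show ?thesis .
qed

section \<open>The reference measure in fibre coordinates\<close>

text \<open>\<open>d_inf\<close> and the Euclidean distance bound each other up to a factor 2. This
  reduces all measurability questions on the space to Borel sets of the plane.\<close>

lemma mtopology_of_subgraph_space: "mtopology_of (subgraph_space f) = top_of_set (subgraph f)"
proof -
  interpret Metric_space "subgraph f" d_inf by (rule Metric_space_d_inf)
  have d1: "d_inf p q \<le> dist p q" for p q
    by (cases p; cases q)
       (auto simp: d_inf_def dist_Pair_Pair dist_real_def intro: real_le_rsqrt order_trans[OF _ real_sqrt_sum_squares_ge1]
          order_trans[OF _ real_sqrt_sum_squares_ge2])
  have d2: "dist p q \<le> 2 * d_inf p q" for p q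
    using sqrt_sum_squares_le_sum_abs[of "fst p - fst q" "snd p - snd q"]
    by (cases p; cases q) (auto simp: d_inf_def dist_Pair_Pair dist_real_def max_def)
  have "openin mtopology U \<longleftrightarrow> openin (top_of_set (subgraph f)) U" for U
  proof
    assume U: "openin mtopology U"
    show "openin (top_of_set (subgraph f)) U"
      unfolding openin_euclidean_subtopology_iff
    proof (intro conjI ballI)
      show "U \<subseteq> subgraph f" using U by (simp add: openin_mtopology)
      fix x assume "x \<in> U"
      then obtain r where "r > 0" "mball x r \<subseteq> U" using U unfolding openin_mtopology by blast
      moreover have "x \<in> subgraph f" using \<open>x \<in> U\<close> \<open>U \<subseteq> subgraph f\<close> by auto
      ultimately show "\<exists>e>0. \<forall>x'\<in>subgraph f. dist x' x < e \<longrightarrow> x' \<in> U"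
        using order_le_less_trans[OF d1[of x]] by (intro exI[of _ r]) (auto simp: dist_commute)
    qed
  next
    assume U: "openin (top_of_set (subgraph f)) U"
    show "openin mtopology U"
      unfolding openin_mtopology
    proof (intro conjI allI impI)
      show "U \<subseteq> subgraph f" using U openin_imp_subset by blast
      fix x assume "x \<in> U"
      then obtain e where e: "e > 0" "\<forall>x'\<in>subgraph f. dist x' x < e \<longrightarrow> x' \<in> U"
        using U unfolding openin_euclidean_subtopology_iff by blast
      have "mball x (e/2) \<subseteq> U"
      proof
        fix y assume "y \<in> mball x (e/2)"
        then have "y \<in> subgraph f" "d_inf x y < e/2" by auto
        then show "y \<in> U" using d2[of x y] e(2) by (auto simp: dist_commute)
      qed
      then show "\<exists>r>0. mball x r \<subseteq> U" using e(1) by (intro exI[of _ "e/2"]) auto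
    qed
  qed
  then have "mtopology = top_of_set (subgraph f)" by (simp add: topology_eq)
  then show ?thesis by (simp add: subgraph_space_def)
qed

lemma subgraph_borel:
  assumes [measurable]: "f \<in> borel_measurable borel"
  shows "subgraph f \<in> sets borel"
proof -
  have "subgraph f = {p \<in> space (borel \<Otimes>\<^sub>M borel). fst p \<in> {-1..1} \<and> 0 \<le> snd p \<and> snd p \<le> f (fst p)}"
    by (auto simp: subgraph_def space_pair_measure)
  also have "\<dots> \<in> sets (borel \<Otimes>\<^sub>M borel)" by measurable
  finally show ?thesis unfolding borel_prod .
qed

lemma sets_borel_of_subgraph_space:
  assumes [measurable]: "f \<in> borel_measurable borel"
  shows "sets (borel_of_metric (subgraph_space f)) = sets (restrict_space borel (subgraph f))"
proof -
  have "sets (borel_of_metric (subgraph_space f)) = sigma_sets (subgraph f) ((\<inter>) (subgraph f) ` {U. open U})"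
    by (auto simp: sets_borel_of_metric mtopology_of_subgraph_space openin_open image_def Int_commute
        intro!: arg_cong[where f="sigma_sets _"])
  also have "\<dots> = (\<inter>) (subgraph f) ` sigma_sets UNIV {U. open U}"
    using subgraph_borel[OF assms] by (subst sigma_sets_Int) (auto simp: borel_def)
  finally show ?thesis
    by (simp add: sets_restrict_space borel_def)
qed

lemma measurable_subgraph_spaceI:
  assumes "f \<in> borel_measurable borel" "g \<in> M \<rightarrow>\<^sub>M borel" "\<And>x. x \<in> space M \<Longrightarrow> g x \<in> subgraph f"
  shows "g \<in> M \<rightarrow>\<^sub>M borel_of_metric (subgraph_space f)"
proof -
  have "g \<in> M \<rightarrow>\<^sub>M restrict_space borel (subgraph f)"
    using assms by (intro measurable_restrict_space2) auto
  then show ?thesis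
    using sets_borel_of_subgraph_space[OF assms(1)] by (simp cong: measurable_cong_sets)
qed

lemma measurable_subgraph_spaceD:
  assumes "f \<in> borel_measurable borel" "g \<in> borel \<rightarrow>\<^sub>M N"
  shows "g \<in> borel_of_metric (subgraph_space f) \<rightarrow>\<^sub>M N"
  using sets_borel_of_subgraph_space[OF assms(1)] measurable_restrict_space1[OF assms(2)]
  by (simp cong: measurable_cong_sets)

text \<open>In the coordinates \<open>(x, y / f x)\<close> the reference measure is a product: this is its second factor.\<close>

definition fibre_measure :: "real \<Rightarrow> real measure" where
  "fibre_measure K = density lborel (\<lambda>s. ennreal (indicator {0..1} s * exp (- K * s\<^sup>2)))"

definition fibre_mass :: "real \<Rightarrow> real" where
  "fibre_mass K = integral {0..1} (\<lambda>y. exp (- K * y\<^sup>2))"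

text \<open>Both coordinates are clamped so that the map is total with values in the subgraph. Over
  the needle it collapses the whole fibre to one point.\<close>

definition fibre_chart :: "(real \<Rightarrow> real) \<Rightarrow> real \<times> real \<Rightarrow> real \<times> real" where
  "fibre_chart f p = (let x = max (-1) (min 1 (fst p)) in (x, max 0 (min 1 (snd p)) * f x))"

definition slab :: "real set \<Rightarrow> real \<Rightarrow> (real \<times> real) measure" where
  "slab I K = density lborel (indicator I) \<Otimes>\<^sub>M fibre_measure K"

lemma sets_fibre_measure [simp, measurable_cong]: "sets (fibre_measure K) = sets borel"
  and space_fibre_measure [simp]: "space (fibre_measure K) = UNIV"
  by (simp_all add: fibre_measure_def)

lemma emeasure_fibre_measure_Icc:
  assumes "0 \<le> a" "a \<le> b" "b \<le> 1"
  shows "emeasure (fibre_measure K) {a..b} = ennreal (integral {a..b} (\<lambda>y. exp (- K * y\<^sup>2)))"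
proof -
  have "emeasure (fibre_measure K) {a..b}
      = (\<integral>\<^sup>+ s. ennreal (indicator {0..1} s * exp (- K * s\<^sup>2)) * indicator {a..b} s \<partial>lborel)"
    by (simp add: fibre_measure_def emeasure_density)
  also have "\<dots> = (\<integral>\<^sup>+ s. ennreal (indicator {a..b} s * exp (- K * s\<^sup>2)) \<partial>lborel)"
    using assms by (intro nn_integral_cong) (auto split: split_indicator)
  also have "\<dots> = ennreal (integral {a..b} (\<lambda>y. exp (- K * y\<^sup>2)))"
  proof (rule nn_integral_has_integral_lebesgue)
    show "((\<lambda>y. exp (- K * y\<^sup>2)) has_integral integral {a..b} (\<lambda>y. exp (- K * y\<^sup>2))) {a..b}"
      by (intro integrable_integral integrable_continuous_real continuous_intros)
  qed auto
  finally show ?thesis .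
qed

lemma emeasure_fibre_measure_UNIV: "emeasure (fibre_measure K) UNIV = ennreal (fibre_mass K)"
proof -
  have "emeasure (fibre_measure K) UNIV = emeasure (fibre_measure K) {0..1}"
    by (auto simp: fibre_measure_def emeasure_density intro!: nn_integral_cong split: split_indicator)
  then show ?thesis
    using emeasure_fibre_measure_Icc[of 0 1 K] by (simp add: fibre_mass_def)
qed

lemma fibre_mass_pos: "0 < fibre_mass K"
proof -
  have "integral {0..1::real} (\<lambda>y. exp (- \<bar>K\<bar>)) \<le> fibre_mass K"
    unfolding fibre_mass_def
  proof (rule Henstock_Kurzweil_Integration.integral_le)
    show "exp (- \<bar>K\<bar>) \<le> exp (- K * y\<^sup>2)" if "y \<in> {0..1}" for y
    proof -
      have "K * y\<^sup>2 \<le> \<bar>K\<bar> * 1"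
        using that by (intro mult_mono) (auto simp: power_le_one)
      then show ?thesis by simp
    qed
  qed (auto intro!: integrable_continuous_real continuous_intros)
  then show ?thesis by (simp add: less_le_trans[OF exp_gt_zero])
qed

lemma finite_measure_fibre_measure: "finite_measure (fibre_measure K)"
  by (rule finite_measureI) (simp add: emeasure_fibre_measure_UNIV)

lemma AE_fibre_measure: "AE s in fibre_measure K. s \<in> {0..1}"
  unfolding fibre_measure_def by (subst AE_density) (auto split: split_indicator)

lemma measurable_fibre_chart:
  assumes [measurable]: "f \<in> borel_measurable borel" and nn: "\<And>x. 0 \<le> f x"
  shows "fibre_chart f \<in> borel \<Otimes>\<^sub>M borel \<rightarrow>\<^sub>M borel_of_metric (subgraph_space f)"
proof (rule measurable_subgraph_spaceI)
  show "fibre_chart f \<in> borel \<Otimes>\<^sub>M borel \<rightarrow>\<^sub>M borel"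
    unfolding fibre_chart_def Let_def borel_prod[symmetric] by measurable
  show "fibre_chart f p \<in> subgraph f" for p
    using nn by (auto simp: fibre_chart_def subgraph_def Let_def intro!: mult_left_le_one_le)
qed fact

lemma sets_slab [simp, measurable_cong]: "sets (slab I K) = sets (borel \<Otimes>\<^sub>M borel)"
  unfolding slab_def by (rule sets_pair_measure_cong) simp_all

lemma space_slab [simp]: "space (slab I K) = UNIV"
  by (simp add: slab_def space_pair_measure)

lemma nn_integral_slab:
  assumes [measurable]: "g \<in> borel_measurable (borel \<Otimes>\<^sub>M borel)" "I \<in> sets borel"
  shows "(\<integral>\<^sup>+p. g p \<partial>slab I K) = (\<integral>\<^sup>+x. indicator I x * (\<integral>\<^sup>+s. g (x, s) \<partial>fibre_measure K) \<partial>lborel)"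
proof -
  interpret finite_measure "fibre_measure K" by (rule finite_measure_fibre_measure)
  have "g \<in> borel_measurable (density lborel (indicator I) \<Otimes>\<^sub>M fibre_measure K)" by measurable
  then have "(\<integral>\<^sup>+p. g p \<partial>slab I K)
      = (\<integral>\<^sup>+x. (\<integral>\<^sup>+s. g (x, s) \<partial>fibre_measure K) \<partial>density lborel (indicator I))"
    unfolding slab_def by (simp add: nn_integral_fst)
  also have "\<dots> = (\<integral>\<^sup>+x. indicator I x * (\<integral>\<^sup>+s. g (x, s) \<partial>fibre_measure K) \<partial>lborel)"
    by (intro nn_integral_density) measurable
  finally show ?thesis .
qed

lemma nn_integral_fibre_measure:
  assumes [measurable]: "g \<in> borel_measurable borel"
  shows "(\<integral>\<^sup>+s. g s \<partial>fibre_measure K) = (\<integral>\<^sup>+s. ennreal (indicator {0..1} s * exp (- K * s\<^sup>2)) * g s \<partial>lborel)"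
  unfolding fibre_measure_def by (intro nn_integral_density) measurable

text \<open>The substitution \<open>y = c * s\<close>, whose Jacobian cancels the factor
  \<open>1 / c\<close> of the planar density. As \<open>B\<close> lies in \<open>{0..c}\<close>, the
  cut-off of the fibre measure to \<open>{0..1}\<close> loses nothing.\<close>

lemma nn_integral_fibre_rescale:
  fixes c :: real and B :: "real set"
  assumes "0 < c" and [measurable]: "B \<in> sets borel" and B: "B \<subseteq> {0..c}"
  shows "(\<integral>\<^sup>+s. indicator B (s * c) \<partial>fibre_measure K)
    = (\<integral>\<^sup>+y. ennreal (1 / c * exp (- K * (y / c)\<^sup>2)) * indicator B y \<partial>lborel)"
proof -
  have "(\<integral>\<^sup>+y. ennreal (1 / c * exp (- K * (y / c)\<^sup>2)) * indicator B y \<partial>lborel)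
    = ennreal \<bar>c\<bar> * (\<integral>\<^sup>+s. ennreal (1 / c * exp (- K * ((0 + c * s) / c)\<^sup>2)) * indicator B (0 + c * s) \<partial>lborel)"
    using \<open>0 < c\<close> by (intro nn_integral_real_affine) auto
  also have "\<dots> = (\<integral>\<^sup>+s. ennreal \<bar>c\<bar> * (ennreal (1 / c * exp (- K * ((0 + c * s) / c)\<^sup>2)) * indicator B (0 + c * s)) \<partial>lborel)"
    by (intro nn_integral_cmult[symmetric]) measurable
  also have "\<dots> = (\<integral>\<^sup>+s. ennreal (indicator {0..1} s * exp (- K * s\<^sup>2)) * indicator B (s * c) \<partial>lborel)"
  proof (rule nn_integral_cong)
    fix s :: real
    have "s \<in> {0..1}" if "s * c \<in> B"
      using that B \<open>0 < c\<close> by (force simp: zero_le_mult_iff mult_le_cancel_right1)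
    then show "ennreal \<bar>c\<bar> * (ennreal (1 / c * exp (- K * ((0 + c * s) / c)\<^sup>2)) * indicator B (0 + c * s))
      = ennreal (indicator {0..1} s * exp (- K * s\<^sup>2)) * indicator B (s * c)"
      using \<open>0 < c\<close> by (auto simp: mult.commute split: split_indicator simp flip: ennreal_mult')
  qed
  also have "\<dots> = (\<integral>\<^sup>+s. indicator B (s * c) \<partial>fibre_measure K)"
    by (subst nn_integral_fibre_measure) measurable
  finally show ?thesis ..
qed

text \<open>Over the needle, collapsing the fibre yields its mass times length, which is the
  Hausdorff part; where \<open>f\<close> is positive, rescaling each fibre yields the planar part.
  The identity also shows that the set function defining \<open>subgraph_measure\<close> is a
  genuine measure on the Borel sets.\<close>

theorem subgraph_measure_eq_distr_slab:
  assumes f [measurable]: "f \<in> borel_measurable borel" and nn: "\<And>x. 0 \<le> f x"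
  shows "subgraph_measure f K
    = distr (slab {-1..1} K) (borel_of_metric (subgraph_space f)) (fibre_chart f)" (is "_ = ?m")
proof -
  let ?X = "borel_of_metric (subgraph_space f)"
  note chart [measurable] = measurable_fibre_chart[OF assms]
  have eq: "ennreal (integral {0..1} (\<lambda>y. exp (- K * y\<^sup>2))) *
        hausdorff1 (subgraph_space f) (A \<inter> {(x, y). x \<in> {-1..1} \<and> f x = 0 \<and> y = 0})
      + (\<integral>\<^sup>+ p \<in> A \<inter> {(x, y). f x > 0}.
          ennreal (1 / f (fst p) * exp (- K * (snd p / f (fst p))\<^sup>2)) \<partial>lborel) = emeasure ?m A"
    (is "_ * hausdorff1 _ ?A0 + ?I = _") if A: "A \<in> sets ?X" for A
  proof -
    have "A \<in> sets (restrict_space borel (subgraph f))"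
      using A sets_borel_of_subgraph_space[OF f] by simp
    then have Ab: "A \<in> sets borel" and AS: "A \<subseteq> subgraph f"
      using subgraph_borel[OF f] by (auto simp: sets_restrict_space)
    have [measurable]: "A \<in> sets (borel \<Otimes>\<^sub>M borel)" using Ab unfolding borel_prod .
    have inA: "x \<in> {-1..1} \<and> 0 \<le> y \<and> y \<le> f x" if "(x, y) \<in> A" for x y
      using AS that by (auto simp: subgraph_def)
    define Z where "Z = {x. (x, 0) \<in> A \<and> f x = 0}"
    have Z [measurable]: "Z \<in> sets borel"
      unfolding Z_def by measurable
    have "{x. (x, 0) \<in> ?A0} = Z" using inA by (auto simp: Z_def)
    moreover have "?A0 \<subseteq> subgraph f" using AS by auto
    ultimately have H: "hausdorff1 (subgraph_space f) ?A0 = emeasure lborel Z"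
      using hausdorff1_horizontal_le[of ?A0 f] hausdorff1_horizontal_ge[of ?A0 f] Z
      by (intro antisym) auto
    define J where "J x = (if 0 < f x then \<integral>\<^sup>+y. ennreal (1 / f x * exp (- K * (y / f x)\<^sup>2)) * indicator A (x, y) \<partial>lborel else 0)" for x
    have "?I = (\<integral>\<^sup>+p. (if 0 < f (fst p) then ennreal (1 / f (fst p) * exp (- K * (snd p / f (fst p))\<^sup>2)) * indicator A p else 0) \<partial>(lborel \<Otimes>\<^sub>M lborel))"
      unfolding lborel_prod by (intro nn_integral_cong) (auto split: split_indicator)
    also have "\<dots> = (\<integral>\<^sup>+x. \<integral>\<^sup>+y. (if 0 < f x then ennreal (1 / f x * exp (- K * (y / f x)\<^sup>2)) * indicator A (x, y) else 0) \<partial>lborel \<partial>lborel)"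
      by (subst lborel.nn_integral_fst[symmetric]; (simp only: fst_conv snd_conv | measurable))
    also have "\<dots> = (\<integral>\<^sup>+x. J x \<partial>lborel)"
      by (intro nn_integral_cong) (simp add: J_def)
    finally have I: "?I = (\<integral>\<^sup>+x. J x \<partial>lborel)" .
    have J [measurable]: "J \<in> borel_measurable lborel"
      unfolding J_def by measurable
    have "emeasure ?m A = (\<integral>\<^sup>+p. indicator A (fibre_chart f p) \<partial>slab {-1..1} K)"
    proof -
      have "emeasure ?m A = (\<integral>\<^sup>+p. indicator A p \<partial>?m)" using A by simp
      also have "\<dots> = (\<integral>\<^sup>+p. indicator A (fibre_chart f p) \<partial>slab {-1..1} K)"
        using A by (intro nn_integral_distr) auto
      finally show ?thesis .
    qed
    also have "\<dots> = (\<integral>\<^sup>+x. indicator {-1..1} x * (\<integral>\<^sup>+s. indicator A (fibre_chart f (x, s)) \<partial>fibre_measure K) \<partial>lborel)"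
      using A by (intro nn_integral_slab) auto
    also have "\<dots> = (\<integral>\<^sup>+x. ennreal (fibre_mass K) * indicator Z x + J x \<partial>lborel)"
    proof (rule nn_integral_cong)
      fix x :: real
      show "indicator {-1..1} x * (\<integral>\<^sup>+s. indicator A (fibre_chart f (x, s)) \<partial>fibre_measure K)
        = ennreal (fibre_mass K) * indicator Z x + J x"
      proof (cases "x \<in> {-1..1}")
        case False
        then have "(x, y) \<notin> A" for y using inA by blast
        then show ?thesis using False by (simp add: Z_def J_def)
      next
        case True
        \<comment> \<open>Here \<open>x\<close> is in range and almost every \<open>s\<close> lies
          in \<open>{0..1}\<close>, so the clamps of the chart are inactive.\<close>
        have fib: "(\<integral>\<^sup>+s. indicator A (fibre_chart f (x, s)) \<partial>fibre_measure K)
            = (\<integral>\<^sup>+s. indicator (Pair x -` A) (s * f x) \<partial>fibre_measure K)"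
          using AE_fibre_measure[of K]
          by (intro nn_integral_cong_AE, eventually_elim)
             (use True in \<open>auto simp: fibre_chart_def split: split_indicator\<close>)
        have slice: "Pair x -` A \<in> sets borel"
          by (rule sets_Pair1) measurable
        show ?thesis
        proof (cases "f x = 0")
          case True
          then show ?thesis using \<open>x \<in> {-1..1}\<close> fib
            by (auto simp: J_def Z_def emeasure_fibre_measure_UNIV split: split_indicator)
        next
          case False
          then have "0 < f x" using nn[of x] by simp
          moreover have "Pair x -` A \<subseteq> {0..f x}" using inA by auto
          ultimately show ?thesis using \<open>x \<in> {-1..1}\<close> fib slice nn_integral_fibre_rescale[of "f x" "Pair x -` A" K]
            by (auto simp: J_def Z_def indicator_vimage)
        qed
      qed
    qed
    also have "\<dots> = ennreal (fibre_mass K) * emeasure lborel Z + (\<integral>\<^sup>+x. J x \<partial>lborel)"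
      by (subst nn_integral_add) (auto simp: nn_integral_cmult)
    finally show ?thesis
      using H I by (simp add: fibre_mass_def)
  qed
  have "subgraph_measure f K = measure_of (subgraph f) (sets ?X) (emeasure ?m)"
    unfolding subgraph_measure_def
  proof (rule measure_of_eq)
    show "sets ?X \<subseteq> Pow (subgraph f)" using sets.space_closed[of ?X] by simp
    fix A assume "A \<in> sigma_sets (subgraph f) (sets ?X)"
    then have "A \<in> sets ?X" using sets.sigma_sets_eq[of ?X] by simp
    then show "ennreal (integral {0..1} (\<lambda>y. exp (- K * y\<^sup>2))) *
        hausdorff1 (subgraph_space f) (A \<inter> {(x, y). x \<in> {-1..1} \<and> f x = 0 \<and> y = 0})
      + (\<integral>\<^sup>+ p \<in> A \<inter> {(x, y). f x > 0}.
          ennreal (1 / f (fst p) * exp (- K * (snd p / f (fst p))\<^sup>2)) \<partial>lborel) = emeasure ?m A"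
      by (rule eq)
  qed
  also have "\<dots> = measure_of (space ?m) (sets ?m) (emeasure ?m)" by simp
  also have "\<dots> = ?m" by (rule measure_of_of_measure)
  finally show ?thesis .
qed

section \<open>Transport from the needle\<close>

text \<open>Equality case of \<open>(E \<Delta>)\<^sup>2 \<le> E (D\<^sup>2)\<close>.\<close>

lemma (in prob_space) AE_eq_const_of_second_moment:
  fixes D \<Delta> :: "'a \<Rightarrow> real"
  assumes [measurable]: "D \<in> borel_measurable M" "\<Delta> \<in> borel_measurable M"
    and le: "AE x in M. \<bar>\<Delta> x\<bar> \<le> D x" and bound: "AE x in M. D x \<le> B"
    and moment: "(\<integral>\<^sup>+x. ennreal ((D x)\<^sup>2) \<partial>M) \<le> ennreal (L\<^sup>2)"
    and mean: "expectation \<Delta> = L" and "0 \<le> L"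
  shows "AE x in M. \<Delta> x = L \<and> D x = L"
proof -
  have D: "integrable M D"
    by (rule integrable_const_bound[of _ B]) (use le bound in \<open>auto elim!: eventually_elim2\<close>)
  have \<Delta>: "integrable M \<Delta>"
    by (rule integrable_const_bound[of _ B]) (use le bound in \<open>auto elim!: eventually_elim2\<close>)
  have D2: "integrable M (\<lambda>x. (D x)\<^sup>2)"
    by (rule integrable_const_bound[of _ "B\<^sup>2"])
       (use le bound in \<open>auto elim!: eventually_elim2 intro!: power_mono\<close>)
  have "expectation (\<lambda>x. (D x)\<^sup>2) \<le> L\<^sup>2"
    using moment D2 by (subst (asm) nn_integral_eq_integral) auto
  have "L \<le> expectation D"
    unfolding mean[symmetric] using le \<Delta> D by (intro integral_mono_AE) (auto elim: eventually_mono)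
  \<comment> \<open>The second moment of \<open>D\<close> about \<open>L\<close> is nonpositive,
    since the bounds on both moments meet at \<open>L\<close>.\<close>
  have "expectation (\<lambda>x. (D x - L)\<^sup>2) = expectation (\<lambda>x. (D x)\<^sup>2 - 2 * L * D x + L\<^sup>2)"
    by (simp add: power2_diff algebra_simps)
  also have "\<dots> = expectation (\<lambda>x. (D x)\<^sup>2) - 2 * L * expectation D + L\<^sup>2"
    using D D2 by (simp add: prob_space)
  also have "\<dots> \<le> L\<^sup>2 - 2 * L * L + L\<^sup>2"
    using \<open>expectation (\<lambda>x. (D x)\<^sup>2) \<le> L\<^sup>2\<close> mult_left_mono[OF \<open>L \<le> expectation D\<close>, of "2 * L"] \<open>0 \<le> L\<close>
    by linarith
  also have "\<dots> = 0" by (simp add: power2_eq_square)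
  finally have "expectation (\<lambda>x. (D x - L)\<^sup>2) = 0"
    by (intro antisym) auto
  moreover have "integrable M (\<lambda>x. (D x - L)\<^sup>2)"
    using D D2 by (simp add: power2_diff)
  ultimately have DL: "AE x in M. (D x - L)\<^sup>2 = 0"
    by (subst (asm) integral_nonneg_eq_0_iff_AE) auto
  then have "expectation D = expectation (\<lambda>_. L)"
    by (intro integral_cong_AE) auto
  then have "expectation (\<lambda>x. D x - \<Delta> x) = 0"
    using D \<Delta> mean by (simp add: prob_space)
  moreover have "AE x in M. 0 \<le> D x - \<Delta> x" using le by eventually_elim auto
  ultimately have "AE x in M. D x - \<Delta> x = 0"
    using D \<Delta> by (subst (asm) integral_nonneg_eq_0_iff_AE) auto
  with DL show ?thesis by eventually_elim auto
qed

text \<open>The density of the slab does not depend on the first coordinate. Horizontal transport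
  that keeps the fibre coordinate therefore preserves densities with respect to the reference
  measure.\<close>

lemma nn_integral_slab_translate:
  assumes [measurable]: "g \<in> borel_measurable (borel \<Otimes>\<^sub>M borel)"
  shows "(\<integral>\<^sup>+p. g (fst p + c, snd p) \<partial>slab {a..b} K) = (\<integral>\<^sup>+p. g p \<partial>slab {a + c..b + c} K)"
proof -
  interpret finite_measure "fibre_measure K" by (rule finite_measure_fibre_measure)
  have "(\<integral>\<^sup>+p. g p \<partial>slab {a + c..b + c} K)
    = (\<integral>\<^sup>+x. indicator {a + c..b + c} x * (\<integral>\<^sup>+s. g (x, s) \<partial>fibre_measure K) \<partial>lborel)"
    by (rule nn_integral_slab) measurable
  also have "\<dots> = (\<integral>\<^sup>+x. indicator {a + c..b + c} (c + 1 * x) * (\<integral>\<^sup>+s. g (c + 1 * x, s) \<partial>fibre_measure K) \<partial>lborel)"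
    by (subst nn_integral_real_affine[of _ 1 c]) auto
  also have "\<dots> = (\<integral>\<^sup>+x. indicator {a..b} x * (\<integral>\<^sup>+s. g (x + c, s) \<partial>fibre_measure K) \<partial>lborel)"
    by (intro nn_integral_cong) (auto simp: add.commute split: split_indicator)
  also have "\<dots> = (\<integral>\<^sup>+p. g (fst p + c, snd p) \<partial>slab {a..b} K)"
    by (subst nn_integral_slab) auto
  finally show ?thesis ..
qed

lemma emeasure_slab_mono:
  assumes "I \<subseteq> J" "I \<in> sets borel" "J \<in> sets borel" "A \<in> sets (borel \<Otimes>\<^sub>M borel)"
  shows "emeasure (slab I K) A \<le> emeasure (slab J K) A"
proof -
  have "(\<integral>\<^sup>+p. indicator A p \<partial>slab I K) \<le> (\<integral>\<^sup>+p. indicator A p \<partial>slab J K)"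
    using assms by (simp only: nn_integral_slab borel_measurable_indicator)
      (intro nn_integral_mono mult_right_mono, auto split: split_indicator)
  then show ?thesis using assms(4) by simp
qed

lemma emeasure_slab_UNIV:
  assumes "I \<in> sets borel"
  shows "emeasure (slab I K) UNIV = emeasure lborel I * ennreal (fibre_mass K)"
proof -
  have "emeasure (slab I K) UNIV = (\<integral>\<^sup>+p. 1 \<partial>slab I K)" by simp
  also have "\<dots> = emeasure lborel I * ennreal (fibre_mass K)"
    using assms by (subst nn_integral_slab) (auto simp: emeasure_fibre_measure_UNIV nn_integral_multc)
  finally show ?thesis .
qed

lemma AE_slab:
  assumes "I \<in> sets borel"
  shows "AE p in slab I K. fst p \<in> I \<and> snd p \<in> {0..1}"
proof -
  have [measurable]: "I \<in> sets borel" by fact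
  define N where "N = {p :: real \<times> real. \<not> (fst p \<in> I \<and> snd p \<in> {0..1})}"
  have N [measurable]: "N \<in> sets (borel \<Otimes>\<^sub>M borel)"
  proof -
    have "{p \<in> space (borel \<Otimes>\<^sub>M borel). \<not> (fst p \<in> I \<and> snd p \<in> {0..1::real})} \<in> sets (borel \<Otimes>\<^sub>M borel)"
      by measurable
    then show ?thesis by (simp add: N_def space_pair_measure)
  qed
  have "emeasure (slab I K) N = (\<integral>\<^sup>+p. indicator N p \<partial>slab I K)" using N by simp
  also have "\<dots> = (\<integral>\<^sup>+x. indicator I x * (\<integral>\<^sup>+s. indicator N (x, s) \<partial>fibre_measure K) \<partial>lborel)"
    by (rule nn_integral_slab) measurable
  also have "\<dots> = (\<integral>\<^sup>+(x::real). 0 \<partial>lborel)"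
  proof (rule nn_integral_cong)
    fix x
    have "(\<integral>\<^sup>+s. indicator N (x, s) \<partial>fibre_measure K) = (\<integral>\<^sup>+s. 0 \<partial>fibre_measure K)" if "x \<in> I"
      using AE_fibre_measure[of K]
      by (intro nn_integral_cong_AE, eventually_elim) (use that in \<open>auto simp: N_def\<close>)
    then show "indicator I x * (\<integral>\<^sup>+s. indicator N (x, s) \<partial>fibre_measure K) = 0"
      by (auto split: split_indicator)
  qed
  finally have "N \<in> null_sets (slab I K)" using N by (simp add: null_sets_def)
  then show ?thesis by (rule AE_I') (auto simp: N_def)
qed

text \<open>The median exists by the intermediate value theorem. The halves are stated as
  complementary rays so that the later case distinction on height covers every point.\<close>

lemma fibre_median:
  obtains s where "0 \<le> s" "s \<le> 1"
    "emeasure (fibre_measure K) {..s} \<le> ennreal (fibre_mass K / 2)"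
    "emeasure (fibre_measure K) {s<..} \<le> ennreal (fibre_mass K / 2)"
proof -
  let ?e = "\<lambda>y. exp (- K * y\<^sup>2)"
  have int: "?e integrable_on {a..b}" for a b
    by (intro integrable_continuous_real continuous_intros)
  have "continuous_on {0..1} (\<lambda>s. integral {0..s} ?e)"
    by (rule indefinite_integral_continuous_1[OF int])
  moreover have "integral {0..0} ?e \<le> fibre_mass K / 2" "fibre_mass K / 2 \<le> integral {0..1} ?e"
    using fibre_mass_pos[of K] by (auto simp: fibre_mass_def)
  ultimately obtain s where s: "0 \<le> s" "s \<le> 1" "integral {0..s} ?e = fibre_mass K / 2"
    using IVT'[of "\<lambda>s. integral {0..s} ?e" 0 "fibre_mass K / 2" 1] by auto
  have s': "integral {s..1} ?e = fibre_mass K / 2"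
    using Henstock_Kurzweil_Integration.integral_combine[OF s(1,2) int] s(3) by (simp add: fibre_mass_def)
  have le: "emeasure (fibre_measure K) B \<le> emeasure (fibre_measure K) C"
    if "B \<inter> {0..1} \<subseteq> C" "B \<in> sets borel" "C \<in> sets borel" for B C
  proof (rule emeasure_mono_AE)
    show "AE x in fibre_measure K. x \<in> B \<longrightarrow> x \<in> C"
      using AE_fibre_measure[of K] by eventually_elim (use that in auto)
  qed (use that in auto)
  show ?thesis
  proof
    show "emeasure (fibre_measure K) {..s} \<le> ennreal (fibre_mass K / 2)"
      using le[of "{..s}" "{0..s}"] emeasure_fibre_measure_Icc[OF order.refl s(1,2), of K, unfolded s(3)] by auto
    have "{s<..} \<inter> {0..1} \<subseteq> {s..1}" by auto
    then show "emeasure (fibre_measure K) {s<..} \<le> ennreal (fibre_mass K / 2)"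
      using le[of "{s<..}" "{s..1}"] emeasure_fibre_measure_Icc[OF s(1,2) order.refl, of K, unfolded s'] by auto
  qed (use s in auto)
qed

text \<open>For curvature bound 0 the Wasserstein term disappears. The order of quantifiers is kept:
  \<open>\<eta>\<close> comes first and serves every weight.\<close>

lemma strict_CD_0E:
  assumes CD: "strict_CD 0 X m" and \<mu>: "\<mu>0 \<in> P2 X" "\<mu>1 \<in> P2 X"
    "absolutely_continuous m \<mu>0" "absolutely_continuous m \<mu>1" and t: "t \<in> {0..1}"
  obtains \<eta> where "\<eta> \<in> OptGeo X \<mu>0 \<mu>1" "\<forall>F.
      F \<in> borel_measurable (restrict_space (borel_of_metric (curves X)) (Geo X)) \<longrightarrow>
      (\<forall>\<gamma>\<in>Geo X. 0 \<le> F \<gamma> \<and> F \<gamma> \<le> B) \<longrightarrow>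
      (\<integral>\<^sup>+ \<gamma>. ennreal (F \<gamma>) \<partial>restrict_space \<eta> (Geo X)) = 1 \<longrightarrow>
      Ent m (weighted_marginal X \<eta> F t) \<le> ereal (1 - t) * Ent m (weighted_marginal X \<eta> F 0)
        + ereal t * Ent m (weighted_marginal X \<eta> F 1)"
proof -
  from bspec[OF bspec[OF CD[unfolded strict_CD_def Let_def] \<mu>(1)] \<mu>(2), THEN mp, OF \<mu>(3), THEN mp, OF \<mu>(4)]
  obtain \<eta> where \<eta>: "\<eta> \<in> OptGeo X \<mu>0 \<mu>1" and all: "\<forall>F :: (real \<Rightarrow> 'a) \<Rightarrow> real.
      F \<in> borel_measurable (restrict_space (borel_of_metric (curves X)) (Geo X)) \<longrightarrow>
      (\<forall>\<gamma>\<in>Geo X. 0 \<le> F \<gamma>) \<longrightarrow> (\<exists>B. \<forall>\<gamma>\<in>Geo X. F \<gamma> \<le> B) \<longrightarrow>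
      (\<integral>\<^sup>+ \<gamma>. ennreal (F \<gamma>) \<partial>restrict_space \<eta> (Geo X)) = 1 \<longrightarrow>
      (\<forall>t\<in>{0..1}. Ent m (weighted_marginal X \<eta> F t)
        \<le> ereal (1 - t) * Ent m (weighted_marginal X \<eta> F 0) + ereal t * Ent m (weighted_marginal X \<eta> F 1)
          - ereal (0 / 2 * t * (1 - t) * (W2 X (weighted_marginal X \<eta> F 0) (weighted_marginal X \<eta> F 1))\<^sup>2))"
    by (rule bexE)
  show ?thesis
  proof (rule that[OF \<eta>], intro allI impI)
    fix F :: "(real \<Rightarrow> 'a) \<Rightarrow> real"
    assume F: "F \<in> borel_measurable (restrict_space (borel_of_metric (curves X)) (Geo X))"
      "\<forall>\<gamma>\<in>Geo X. 0 \<le> F \<gamma> \<and> F \<gamma> \<le> B" "(\<integral>\<^sup>+ \<gamma>. ennreal (F \<gamma>) \<partial>restrict_space \<eta> (Geo X)) = 1"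
    then have "\<forall>\<gamma>\<in>Geo X. 0 \<le> F \<gamma>" "\<exists>B. \<forall>\<gamma>\<in>Geo X. F \<gamma> \<le> B" by auto
    from all[THEN spec, THEN mp, OF F(1), THEN mp, OF this(1), THEN mp, OF this(2), THEN mp, OF F(3), THEN bspec, OF t]
    show "Ent m (weighted_marginal X \<eta> F t) \<le> ereal (1 - t) * Ent m (weighted_marginal X \<eta> F 0)
        + ereal t * Ent m (weighted_marginal X \<eta> F 1)"
      by (simp add: zero_ereal_def[symmetric])
  qed
qed

text \<open>Isolates the facts about the profile that the transport uses: a needle on the left,
  genuine fibres from \<open>k\<close> on, and height at most 1, so that vertical displacements
  never exceed \<open>L\<close>.\<close>

locale needle =
  fixes f :: "real \<Rightarrow> real" and K k :: real
  assumes f_measurable [measurable]: "f \<in> borel_measurable borel"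
    and f_nonneg: "\<And>x. 0 \<le> f x" and f_le_1: "\<And>x. f x \<le> 1"
    and k: "0 < k" "k < 1"
    and f_zero: "\<And>x. -1 \<le> x \<Longrightarrow> x \<le> -k \<Longrightarrow> f x = 0"
    and f_pos: "\<And>x. k \<le> x \<Longrightarrow> x \<le> 1 \<Longrightarrow> 0 < f x"
begin

text \<open>The transport moves mass from the needle \<open>[-1, -1 + h]\<close> by \<open>L\<close> to \<open>[1 - h, 1]\<close>; at time \<open>\<tau>\<close> it
  occupies \<open>[k, k + h]\<close>, where the space is already two-dimensional.\<close>

definition "h = (1 - k) / 2"
definition "L = 2 - h"
definition "\<tau> = (1 + k) / L"

text \<open>Source and target strips fit beside the interval from \<open>-k\<close> to
  \<open>k\<close> when \<open>h \<le> 1 - k\<close>, and \<open>\<tau> < 1\<close> means exactly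
  \<open>h < 1 - k\<close>; half of \<open>1 - k\<close> is a convenient choice.
  \<open>L \<ge> 1\<close> makes horizontal displacement dominate the height.\<close>

lemma h: "0 < h" "-1 + h \<le> -k" "k + h \<le> 1" and L: "1 \<le> L" "-1 + h + L = 1" "-1 + L = 1 - h"
  and \<tau>: "0 < \<tau>" "\<tau> < 1" "\<tau> * L = 1 + k"
  using k by (auto simp: h_def L_def \<tau>_def field_simps)

abbreviation "X \<equiv> subgraph_space f"
abbreviation "BX \<equiv> borel_of_metric X"
abbreviation "m \<equiv> subgraph_measure f K"
text \<open>The inverse of the reference mass of a strip of width \<open>h\<close>, hence the
  normalising density of both end measures.\<close>

abbreviation "c \<equiv> 1 / (fibre_mass K * h)"

lemma m_eq: "m = distr (slab {-1..1} K) BX (fibre_chart f)"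
  using subgraph_measure_eq_distr_slab[OF f_measurable f_nonneg] .

lemma sets_m [simp, measurable_cong]: "sets m = sets BX"
  and space_m [simp]: "space m = subgraph f"
  by (simp_all add: m_eq)

lemma chart_measurable [measurable]: "fibre_chart f \<in> borel \<Otimes>\<^sub>M borel \<rightarrow>\<^sub>M BX"
  using measurable_fibre_chart[OF f_measurable f_nonneg] .

lemma BX_measurable [measurable (raw)]: "g \<in> borel_measurable borel \<Longrightarrow> g \<in> borel_measurable BX"
  using measurable_subgraph_spaceD[OF f_measurable] .

lemma fst_measurable [measurable]: "fst \<in> borel_measurable BX"
  and snd_measurable [measurable]: "snd \<in> borel_measurable BX"
  by (intro BX_measurable borel_measurable_continuous_onI continuous_intros)+

lemma d_inf_measurable [measurable]: "(\<lambda>p. d_inf (fst p) (snd p)) \<in> borel_measurable (BX \<Otimes>\<^sub>M BX)"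
  unfolding d_inf_def by measurable

lemma c_pos: "0 < c" using h fibre_mass_pos[of K] by simp

lemma finite_measure_m: "finite_measure m"
proof -
  have "finite_measure (slab {-1..1} K)"
    by (rule finite_measureI) (simp add: emeasure_slab_UNIV ennreal_mult_eq_top_iff)
  then show ?thesis
    unfolding m_eq by (rule finite_measure.finite_measure_distr) measurable
qed

text \<open>A common parameter space for both end measures: each is an image of \<open>src\<close>,
  so a pair of maps on it is already a coupling.\<close>

definition "src = scale_measure (ennreal c) (slab {-1..-1 + h} K)"
definition "shift_chart p = fibre_chart f (fst p + L, snd p)"
definition "\<mu>0 = distr src BX (fibre_chart f)"
definition "\<mu>1 = distr src BX shift_chart"

lemma sets_src [simp, measurable_cong]: "sets src = sets (borel \<Otimes>\<^sub>M borel)"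
  by (simp add: src_def)

lemma space_src [simp]: "space src = UNIV"
  using sets_eq_imp_space_eq[OF sets_src] by (simp add: space_pair_measure)

lemma shift_chart_measurable [measurable]: "shift_chart \<in> borel \<Otimes>\<^sub>M borel \<rightarrow>\<^sub>M BX"
  unfolding shift_chart_def by measurable

lemma prob_space_src: "prob_space src"
proof
  have "emeasure src UNIV = ennreal c * (ennreal h * ennreal (fibre_mass K))"
    using h by (simp add: src_def emeasure_slab_UNIV)
  also have "\<dots> = ennreal (c * (h * fibre_mass K))"
    using h fibre_mass_pos[of K] c_pos by (simp only: ennreal_mult'' less_imp_le mult_nonneg_nonneg)
  also have "\<dots> = 1" using h fibre_mass_pos[of K] by simp
  finally show "emeasure src (space src) = 1" by simp
qed

lemma AE_src: "AE p in src. fibre_chart f p = (fst p, 0) \<and> fst p \<in> {-1..-1 + h}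
    \<and> shift_chart p = (fst p + L, snd p * f (fst p + L)) \<and> snd p \<in> {0..1}"
proof -
  have "AE p in slab {-1..-1 + h} K. fst p \<in> {-1..-1 + h} \<and> snd p \<in> {0..1}"
    by (rule AE_slab) simp
  then have "AE p in src. fst p \<in> {-1..-1 + h} \<and> snd p \<in> {0..1}"
    by (auto simp: src_def eventually_ae_filter null_sets_def)
  then show ?thesis
  proof eventually_elim
    case (elim p)
    then have "f (fst p) = 0" using h k by (intro f_zero) auto
    moreover have "fst p \<le> 1" "-1 \<le> fst p + L" "fst p + L \<le> 1" using elim L h k by auto
    ultimately show ?case
      using elim by (auto simp: shift_chart_def fibre_chart_def Let_def)
  qed
qed

lemma \<mu>0_le: "A \<in> sets BX \<Longrightarrow> emeasure \<mu>0 A \<le> ennreal c * emeasure m A"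
proof -
  assume [measurable]: "A \<in> sets BX"
  have S: "fibre_chart f -` A \<in> sets (borel \<Otimes>\<^sub>M borel)"
    using measurable_sets[OF chart_measurable \<open>A \<in> _\<close>] by (simp add: space_pair_measure)
  have "emeasure \<mu>0 A = ennreal c * emeasure (slab {-1..-1 + h} K) (fibre_chart f -` A)"
    by (simp add: \<mu>0_def emeasure_distr) (simp add: src_def)
  also have "\<dots> \<le> ennreal c * emeasure (slab {-1..1} K) (fibre_chart f -` A)"
    using h k S by (intro mult_left_mono emeasure_slab_mono) auto
  also have "emeasure (slab {-1..1} K) (fibre_chart f -` A) = emeasure m A"
    by (simp add: m_eq emeasure_distr)
  finally show ?thesis .
qed

text \<open>In fibre coordinates the target is the source translated by \<open>L\<close>, so its
  density bound is inherited from translation invariance of slabs.\<close>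

lemma \<mu>1_le: "A \<in> sets BX \<Longrightarrow> emeasure \<mu>1 A \<le> ennreal c * emeasure m A"
proof -
  assume A [measurable]: "A \<in> sets BX"
  have S [measurable]: "fibre_chart f -` A \<in> sets (borel \<Otimes>\<^sub>M borel)"
    using measurable_sets[OF chart_measurable A] by (simp add: space_pair_measure)
  have S': "shift_chart -` A \<in> sets (borel \<Otimes>\<^sub>M borel)"
    using measurable_sets[OF shift_chart_measurable A] by (simp add: space_pair_measure)
  have "emeasure \<mu>1 A = ennreal c * emeasure (slab {-1..-1 + h} K) (shift_chart -` A)"
    by (simp add: \<mu>1_def emeasure_distr) (simp add: src_def)
  also have "emeasure (slab {-1..-1 + h} K) (shift_chart -` A)
      = (\<integral>\<^sup>+p. indicator (shift_chart -` A) p \<partial>slab {-1..-1 + h} K)"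
    using S' by simp
  also have "\<dots> = (\<integral>\<^sup>+p. indicator (fibre_chart f -` A) (fst p + L, snd p) \<partial>slab {-1..-1 + h} K)"
    by (intro nn_integral_cong) (simp add: shift_chart_def split: split_indicator)
  also have "\<dots> = (\<integral>\<^sup>+p. indicator (fibre_chart f -` A) p \<partial>slab {-1 + L..-1 + h + L} K)"
    by (rule nn_integral_slab_translate) measurable
  also have "\<dots> = emeasure (slab {1 - h..1} K) (fibre_chart f -` A)"
    using S L by simp
  also have "\<dots> \<le> emeasure (slab {-1..1} K) (fibre_chart f -` A)"
    using h k S by (intro emeasure_slab_mono) auto
  also have "\<dots> = emeasure m A"
    by (simp add: m_eq emeasure_distr)
  finally show ?thesis by (simp add: mult_left_mono)
qed

lemma absolutely_continuous_\<mu>: "absolutely_continuous m \<mu>0" "absolutely_continuous m \<mu>1"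
  using \<mu>0_le \<mu>1_le
  by (fastforce simp: absolutely_continuous_def null_sets_def \<mu>0_def \<mu>1_def)+

lemma prob_space_\<mu>: "prob_space \<mu>0" "prob_space \<mu>1"
  unfolding \<mu>0_def \<mu>1_def by (intro prob_space.prob_space_distr prob_space_src; measurable)+

lemma subgraph_bounds: "p \<in> subgraph f \<Longrightarrow> \<bar>fst p\<bar> \<le> 1 \<and> 0 \<le> snd p \<and> snd p \<le> 1"
  using f_le_1 by (force simp: subgraph_def intro: order_trans)

lemma d_inf_le_2: "p \<in> subgraph f \<Longrightarrow> q \<in> subgraph f \<Longrightarrow> d_inf p q \<le> 2"
  using subgraph_bounds[of p] subgraph_bounds[of q] by (auto simp: d_inf_def)

lemma P2I:
  assumes "prob_space \<mu>" "sets \<mu> = sets BX"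
  shows "\<mu> \<in> P2 X"
proof -
  interpret prob_space \<mu> by fact
  have sp: "space \<mu> = subgraph f" using sets_eq_imp_space_eq[OF assms(2)] by simp
  have z: "(0, 0) \<in> subgraph f" using f_nonneg by (simp add: subgraph_def)
  have "(\<integral>\<^sup>+ x. ennreal ((mdist X x (0, 0))\<^sup>2) \<partial>\<mu>) \<le> (\<integral>\<^sup>+ x. ennreal (2\<^sup>2) \<partial>\<mu>)"
  proof (intro nn_integral_mono ennreal_leI)
    fix x assume "x \<in> space \<mu>"
    then show "(mdist X x (0, 0))\<^sup>2 \<le> 2\<^sup>2"
      using d_inf_le_2[of x "(0, 0)"] z sp
      by (intro power_mono) (auto simp: Metric_space.nonneg[OF Metric_space_d_inf[of UNIV]])
  qed
  also have "\<dots> < \<infinity>" by (simp add: emeasure_space_1)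
  finally show ?thesis using assms z by (auto simp: P2_def)
qed

lemma \<mu>_P2: "\<mu>0 \<in> P2 X" "\<mu>1 \<in> P2 X"
  using prob_space_\<mu> by (auto intro!: P2I simp: \<mu>0_def \<mu>1_def)

definition "shift_plan = distr src (BX \<Otimes>\<^sub>M BX) (\<lambda>p. (fibre_chart f p, shift_chart p))"

lemma shift_plan: "shift_plan \<in> plans X \<mu>0 \<mu>1"
proof -
  have "prob_space shift_plan"
    unfolding shift_plan_def by (intro prob_space.prob_space_distr prob_space_src; measurable)
  then show ?thesis
    unfolding plans_def by (auto simp: shift_plan_def \<mu>0_def \<mu>1_def distr_distr comp_def)
qed

text \<open>The shift raises a point by at most 1, which is at most \<open>L\<close>, so almost
  every pair is at distance exactly \<open>L\<close>. This competitor bounds the cost of every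
  optimal plan.\<close>

lemma cost_shift_plan: "transport_cost X shift_plan \<le> ennreal (L\<^sup>2)"
proof -
  interpret prob_space src by (rule prob_space_src)
  have "transport_cost X shift_plan = (\<integral>\<^sup>+p. ennreal ((d_inf (fibre_chart f p) (shift_chart p))\<^sup>2) \<partial>src)"
    by (simp add: transport_cost_def shift_plan_def nn_integral_distr)
  also have "\<dots> \<le> (\<integral>\<^sup>+p. ennreal (L\<^sup>2) \<partial>src)"
  proof (intro nn_integral_mono_AE)
    show "AE p in src. ennreal ((d_inf (fibre_chart f p) (shift_chart p))\<^sup>2) \<le> ennreal (L\<^sup>2)"
      using AE_src
    proof eventually_elim
      case (elim p)
      have "snd p * f (fst p + L) \<le> 1 * 1"
        using elim f_le_1 f_nonneg by (intro mult_mono) auto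
      moreover have "0 \<le> snd p * f (fst p + L)" using elim f_nonneg by simp
      ultimately have "d_inf (fibre_chart f p) (shift_chart p) = L"
        using elim L(1) by (auto simp: d_inf_def)
      then show ?case by simp
    qed
  qed
  also have "\<dots> = ennreal (L\<^sup>2)" using emeasure_space_1 by simp
  finally show ?thesis .
qed

lemma \<mu>0_AE: "AE p in \<mu>0. snd p = 0 \<and> fst p \<in> {-1..-1 + h}"
proof -
  have "AE p in src. snd (fibre_chart f p) = 0 \<and> fst (fibre_chart f p) \<in> {-1..-1 + h}"
    using AE_src by eventually_elim auto
  moreover have "{p \<in> space BX. snd p = 0 \<and> fst p \<in> {-1..-1 + h}} \<in> sets BX" by measurable
  moreover have "fibre_chart f \<in> src \<rightarrow>\<^sub>M BX" by measurable
  ultimately show ?thesis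
    unfolding \<mu>0_def by (simp only: AE_distr_iff)
qed

text \<open>A difference of means depends on the marginals only, so every coupling has mean
  horizontal displacement \<open>L\<close>; this supplies the lower bound matching the cost of the
  shift.\<close>

lemma mean_displacement: "integral\<^sup>L \<mu>1 fst - integral\<^sup>L \<mu>0 fst = L"
proof -
  interpret prob_space src by (rule prob_space_src)
  have bounds: "AE p in src. \<bar>fst p\<bar> \<le> 2"
    using AE_src by eventually_elim (use k h in auto)
  have int: "integrable src fst"
    by (rule integrable_const_bound[of _ 2]) (use bounds in \<open>auto simp: measurable_fst\<close>)
  have "integral\<^sup>L \<mu>0 fst = expectation (\<lambda>p. fst (fibre_chart f p))"
    unfolding \<mu>0_def by (rule integral_distr) measurable
  also have "\<dots> = expectation fst"
  proof (rule integral_cong_AE)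
    show "AE p in src. fst (fibre_chart f p) = fst p" using AE_src by eventually_elim auto
  qed measurable
  finally have 0: "integral\<^sup>L \<mu>0 fst = expectation fst" .
  have "integral\<^sup>L \<mu>1 fst = expectation (\<lambda>p. fst (shift_chart p))"
    unfolding \<mu>1_def by (rule integral_distr) measurable
  also have "\<dots> = expectation (\<lambda>p. fst p + L)"
  proof (rule integral_cong_AE)
    show "AE p in src. fst (shift_chart p) = fst p + L" using AE_src by eventually_elim auto
  qed measurable
  also have "\<dots> = expectation fst + L"
    using int prob_space by simp
  finally show ?thesis using 0 by simp
qed

section \<open>Rigidity of the horizontal motion of optimal geodesics\<close>

lemma curve_in_subgraph: "\<gamma> \<in> mspace (curves X) \<Longrightarrow> t \<in> {0..1} \<Longrightarrow> \<gamma> t \<in> subgraph f"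
  unfolding curves_def by auto

text \<open>Horizontal displacement has mean \<open>L\<close> and is bounded by the distance, whose
  second moment is at most \<open>L\<^sup>2\<close> by comparison with the shift. The equality case
  forces both to equal \<open>L\<close> almost surely.\<close>

lemma OptGeo_displacement:
  assumes \<eta>: "\<eta> \<in> OptGeo X \<mu>0 \<mu>1"
  shows "distr \<eta> BX (\<lambda>\<gamma>. \<gamma> 0) = \<mu>0" "distr \<eta> BX (\<lambda>\<gamma>. \<gamma> 1) = \<mu>1"
    "AE \<gamma> in \<eta>. fst (\<gamma> 1) - fst (\<gamma> 0) = L \<and> d_inf (\<gamma> 0) (\<gamma> 1) = L"
proof -
  interpret prob_space \<eta> using \<eta> by (simp add: OptGeo_def)
  have sets [measurable_cong]: "sets \<eta> = sets (borel_of_metric (curves X))" using \<eta> by (simp add: OptGeo_def)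
  have sp: "space \<eta> = mspace (curves X)" using sets_eq_imp_space_eq[OF sets] by simp
  have e [measurable]: "(\<lambda>\<gamma>. \<gamma> 0) \<in> \<eta> \<rightarrow>\<^sub>M BX" "(\<lambda>\<gamma>. \<gamma> 1) \<in> \<eta> \<rightarrow>\<^sub>M BX"
    using measurable_curves_eval[of 0 X] measurable_curves_eval[of 1 X] by (simp_all cong: measurable_cong_sets add: sets)
  define \<pi> where "\<pi> = distr \<eta> (BX \<Otimes>\<^sub>M BX) (\<lambda>\<gamma>. (\<gamma> 0, \<gamma> 1))"
  have opt: "optimal_plan X \<mu>0 \<mu>1 \<pi>" using \<eta> by (simp add: OptGeo_def \<pi>_def)
  then show d0: "distr \<eta> BX (\<lambda>\<gamma>. \<gamma> 0) = \<mu>0" and d1: "distr \<eta> BX (\<lambda>\<gamma>. \<gamma> 1) = \<mu>1"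
    by (simp_all add: optimal_plan_def plans_def \<pi>_def distr_distr comp_def)
  have [measurable]: "(\<lambda>\<gamma>. d_inf (\<gamma> 0) (\<gamma> 1)) \<in> borel_measurable \<eta>"
    unfolding d_inf_def by measurable
  have "(\<integral>\<^sup>+\<gamma>. ennreal ((d_inf (\<gamma> 0) (\<gamma> 1))\<^sup>2) \<partial>\<eta>) = transport_cost X \<pi>"
    by (simp add: transport_cost_def \<pi>_def nn_integral_distr)
  also have "\<dots> \<le> transport_cost X shift_plan"
    using opt shift_plan by (auto simp: optimal_plan_def)
  also note cost_shift_plan
  finally have cost: "(\<integral>\<^sup>+\<gamma>. ennreal ((d_inf (\<gamma> 0) (\<gamma> 1))\<^sup>2) \<partial>\<eta>) \<le> ennreal (L\<^sup>2)" .
  have bd: "\<bar>fst (\<gamma> t)\<bar> \<le> 1" if "\<gamma> \<in> space \<eta>" "t \<in> {0..1}" for \<gamma> t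
    using subgraph_bounds[OF curve_in_subgraph[of \<gamma> t]] that sp by simp
  have i: "integrable \<eta> (\<lambda>\<gamma>. fst (\<gamma> 0))" "integrable \<eta> (\<lambda>\<gamma>. fst (\<gamma> 1))"
    by (rule integrable_const_bound[of _ 1], rule AE_I2, use bd in simp, measurable)+
  have "expectation (\<lambda>\<gamma>. fst (\<gamma> 1) - fst (\<gamma> 0)) = integral\<^sup>L (distr \<eta> BX (\<lambda>\<gamma>. \<gamma> 1)) fst - integral\<^sup>L (distr \<eta> BX (\<lambda>\<gamma>. \<gamma> 0)) fst"
    using i integral_distr[OF e(1) fst_measurable] integral_distr[OF e(2) fst_measurable] by simp
  then have mean: "expectation (\<lambda>\<gamma>. fst (\<gamma> 1) - fst (\<gamma> 0)) = L"
    using mean_displacement d0 d1 by simp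
  show "AE \<gamma> in \<eta>. fst (\<gamma> 1) - fst (\<gamma> 0) = L \<and> d_inf (\<gamma> 0) (\<gamma> 1) = L"
  proof (rule AE_eq_const_of_second_moment[where B = 2])
    show "AE \<gamma> in \<eta>. d_inf (\<gamma> 0) (\<gamma> 1) \<le> 2"
      using sp by (intro AE_I2 d_inf_le_2 curve_in_subgraph) auto
    show "AE \<gamma> in \<eta>. \<bar>fst (\<gamma> 1) - fst (\<gamma> 0)\<bar> \<le> d_inf (\<gamma> 0) (\<gamma> 1)"
      by (rule AE_I2) (simp add: d_inf_def abs_minus_commute)
  qed (use cost mean L in auto)
qed

text \<open>The first coordinate gains at most \<open>t * L\<close> before time \<open>t\<close> and
  at most \<open>(1 - t) * L\<close> afterwards; a total gain of \<open>L\<close> forces equality in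
  both.\<close>

lemma Geo_fst_affine:
  assumes "\<gamma> \<in> Geo X" "fst (\<gamma> 1) - fst (\<gamma> 0) = L" "d_inf (\<gamma> 0) (\<gamma> 1) = L" "t \<in> {0..1}"
  shows "fst (\<gamma> t) = fst (\<gamma> 0) + t * L"
proof -
  have "d_inf (\<gamma> 0) (\<gamma> t) = t * L" "d_inf (\<gamma> t) (\<gamma> 1) = (1 - t) * L"
  proof -
    have geo: "d_inf (\<gamma> u) (\<gamma> v) = \<bar>u - v\<bar> * L" if "u \<in> {0..1}" "v \<in> {0..1}" for u v
    proof -
      have "mdist X (\<gamma> u) (\<gamma> v) = \<bar>u - v\<bar> * mdist X (\<gamma> 0) (\<gamma> 1)"
        using assms(1) that unfolding Geo_def by blast
      then show ?thesis using assms(3) by simp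
    qed
    show "d_inf (\<gamma> 0) (\<gamma> t) = t * L" "d_inf (\<gamma> t) (\<gamma> 1) = (1 - t) * L"
      using geo[of 0 t] geo[of t 1] assms(4) by auto
  qed
  then have "fst (\<gamma> t) - fst (\<gamma> 0) \<le> t * L" "fst (\<gamma> 1) - fst (\<gamma> t) \<le> (1 - t) * L"
    by (auto simp: d_inf_def max_def split: if_splits)
  then show ?thesis using assms(2) by (simp add: algebra_simps)
qed

text \<open>\<open>S\<close> will carry the selected mass at time \<open>\<tau>\<close>. Whether the
  lower or the upper half is taken at \<open>x\<close> is decided by the starting point
  \<open>(x - (1 + k), 0)\<close>, so every fibre over \<open>{k..k + h}\<close> contributes at most
  half its mass, in total \<open>h * fibre_mass K / 2\<close>, which is
  \<open>1 / (2 * c)\<close>.\<close>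

lemma emeasure_half_slab:
  assumes s: "emeasure (fibre_measure K) {..s} \<le> ennreal (fibre_mass K / 2)"
      "emeasure (fibre_measure K) {s<..} \<le> ennreal (fibre_mass K / 2)"
    and D: "D \<in> sets BX"
  defines "S \<equiv> {p \<in> subgraph f. fst p \<in> {k..k + h} \<and>
      ((fst p - (1 + k), 0) \<in> D \<longleftrightarrow> snd p \<le> s * f (fst p))}"
  shows "S \<in> sets BX" "emeasure m S \<le> ennreal (1 / (2 * c))"
proof -
  have "D \<in> sets borel"
    using D sets_borel_of_subgraph_space[OF f_measurable] subgraph_borel[OF f_measurable]
    by (auto simp: sets_restrict_space)
  then have [measurable]: "D \<in> sets (borel \<Otimes>\<^sub>M borel)" unfolding borel_prod .
  define D' where "D' = {x. (x - (1 + k), 0) \<in> D}"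
  have D' [measurable]: "D' \<in> sets borel" unfolding D'_def by measurable
  have "S = {p \<in> space BX. fst p \<in> {k..k + h} \<and> (fst p \<in> D' \<longleftrightarrow> snd p \<le> s * f (fst p))}"
    by (simp add: S_def D'_def)
  also have "\<dots> \<in> sets BX" by measurable
  finally show S: "S \<in> sets BX" .
  \<comment> \<open>\<open>T\<close> is \<open>S\<close> seen in fibre coordinates; the height
    comparison may be divided by \<open>f\<close>, which is positive over
    \<open>{k..k + h}\<close>.\<close>
  define T where "T = {p :: real \<times> real. fst p \<in> {k..k + h} \<and> (fst p \<in> D' \<longleftrightarrow> snd p \<le> s)}"
  have T: "T \<in> sets (borel \<Otimes>\<^sub>M borel)"
  proof -
    have "{p \<in> space (borel \<Otimes>\<^sub>M borel). fst p \<in> {k..k + h} \<and> (fst p \<in> D' \<longleftrightarrow> snd p \<le> s)} \<in> sets (borel \<Otimes>\<^sub>M borel)"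
      by measurable
    then show ?thesis by (simp add: T_def space_pair_measure)
  qed
  note [measurable] = T
  have "emeasure m S = emeasure (slab {-1..1} K) (fibre_chart f -` S)"
    using S by (simp add: m_eq emeasure_distr)
  also have "\<dots> \<le> emeasure (slab {-1..1} K) T"
  proof (rule emeasure_mono_AE)
    have "AE p in slab {-1..1} K. fst p \<in> {-1..1} \<and> snd p \<in> {0..1}"
      by (rule AE_slab) simp
    then show "AE p in slab {-1..1} K. p \<in> fibre_chart f -` S \<longrightarrow> p \<in> T"
    proof eventually_elim
      case (elim p)
      then have chart: "fibre_chart f p = (fst p, snd p * f (fst p))"
        by (auto simp: fibre_chart_def Let_def)
      show ?case
      proof
        assume "p \<in> fibre_chart f -` S"
        then have p: "fst p \<in> {k..k + h}" "fst p \<in> D' \<longleftrightarrow> snd p * f (fst p) \<le> s * f (fst p)"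
          by (auto simp: S_def D'_def chart)
        moreover have "0 < f (fst p)" using p(1) elim by (intro f_pos) auto
        ultimately show "p \<in> T" by (simp add: T_def)
      qed
    qed
  qed (use T in simp)
  also have "\<dots> = (\<integral>\<^sup>+p. indicator T p \<partial>slab {-1..1} K)" using T by simp
  also have "\<dots> = (\<integral>\<^sup>+x. indicator {-1..1} x * (\<integral>\<^sup>+y. indicator T (x, y) \<partial>fibre_measure K) \<partial>lborel)"
    by (rule nn_integral_slab) measurable
  also have "\<dots> \<le> (\<integral>\<^sup>+x. ennreal (fibre_mass K / 2) * indicator {k..k + h} x \<partial>lborel)"
  proof (rule nn_integral_mono)
    fix x
    have "(\<integral>\<^sup>+y. indicator T (x, y) \<partial>fibre_measure K) = (\<integral>\<^sup>+y. indicator {k..k + h} x *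
        indicator (if x \<in> D' then {..s} else {s<..}) y \<partial>fibre_measure K)"
      by (intro nn_integral_cong) (auto simp: T_def split: split_indicator)
    also have "\<dots> = indicator {k..k + h} x * emeasure (fibre_measure K) (if x \<in> D' then {..s} else {s<..})"
      by (subst nn_integral_cmult) auto
    also have "\<dots> \<le> indicator {k..k + h} x * ennreal (fibre_mass K / 2)"
      using s by (intro mult_left_mono) auto
    finally show "indicator {-1..1} x * (\<integral>\<^sup>+y. indicator T (x, y) \<partial>fibre_measure K)
        \<le> ennreal (fibre_mass K / 2) * indicator {k..k + h} x"
      by (auto simp: mult.commute split: split_indicator)
  qed
  also have "\<dots> = ennreal (fibre_mass K / 2) * ennreal h"
    using h by (simp add: nn_integral_cmult)
  also have "\<dots> = ennreal (1 / (2 * c))"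
    using h fibre_mass_pos[of K] by (simp flip: ennreal_mult)
  finally show "emeasure m S \<le> ennreal (1 / (2 * c))" .
qed

theorem not_strict_CD: "\<not> strict_CD 0 X m"
proof
  assume "strict_CD 0 X m"
  have \<tau>': "\<tau> \<in> {0..1}" using \<tau> by auto
  obtain \<eta> where \<eta>: "\<eta> \<in> OptGeo X \<mu>0 \<mu>1" and CD: "\<forall>F.
      F \<in> borel_measurable (restrict_space (borel_of_metric (curves X)) (Geo X)) \<longrightarrow>
      (\<forall>\<gamma>\<in>Geo X. 0 \<le> F \<gamma> \<and> F \<gamma> \<le> 2) \<longrightarrow>
      (\<integral>\<^sup>+ \<gamma>. ennreal (F \<gamma>) \<partial>restrict_space \<eta> (Geo X)) = 1 \<longrightarrow>
      Ent m (weighted_marginal X \<eta> F \<tau>) \<le> ereal (1 - \<tau>) * Ent m (weighted_marginal X \<eta> F 0)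
        + ereal \<tau> * Ent m (weighted_marginal X \<eta> F 1)"
    by (rule strict_CD_0E[OF \<open>strict_CD 0 X m\<close> \<mu>_P2 absolutely_continuous_\<mu> \<tau>', where B = 2])
  interpret \<eta>: prob_space \<eta> using \<eta> by (simp add: OptGeo_def)
  have sets: "sets \<eta> = sets (borel_of_metric (curves X))" using \<eta> by (simp add: OptGeo_def)
  have sp: "space \<eta> = mspace (curves X)" using sets_eq_imp_space_eq[OF sets] by simp
  have Geo [measurable]: "Geo X \<in> sets \<eta>" using sets sets_Geo by simp
  have GeoX: "Geo X \<subseteq> mspace (curves X)" by (auto simp: Geo_def)
  have AE_Geo: "AE \<gamma> in \<eta>. \<gamma> \<in> Geo X" using \<eta> by (simp add: OptGeo_def)
  \<comment> \<open>Weights are defined on geodesics only. Since these carry all of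
    \<open>\<eta>\<close>, the restriction is again a probability measure with the same
    marginals.\<close>
  define M where "M = restrict_space \<eta> (Geo X)"
  have spM: "space M = Geo X" using GeoX sp by (auto simp: M_def space_restrict_space)
  have "emeasure M (space M) = emeasure \<eta> (Geo X)"
    unfolding spM unfolding M_def by (subst emeasure_restrict_space) (use Geo in auto)
  also have "\<dots> = 1" using AE_Geo Geo by (intro \<eta>.emeasure_eq_1_AE) auto
  finally have "prob_space M" by (rule prob_spaceI)
  interpret M: prob_space M by fact
  have e: "(\<lambda>\<gamma>. \<gamma> t) \<in> M \<rightarrow>\<^sub>M BX" if "t \<in> {0..1}" for t
    unfolding M_def using measurable_curves_eval[OF that, of X]
    by (intro measurable_restrict_space1) (simp cong: measurable_cong_sets add: sets)
  have e_meas [measurable]: "(\<lambda>\<gamma>. \<gamma> 0) \<in> M \<rightarrow>\<^sub>M BX" "(\<lambda>\<gamma>. \<gamma> 1) \<in> M \<rightarrow>\<^sub>M BX" "(\<lambda>\<gamma>. \<gamma> \<tau>) \<in> M \<rightarrow>\<^sub>M BX"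
    using e \<tau>' by auto
  have distr_M: "distr M BX (\<lambda>\<gamma>. \<gamma> t) = distr \<eta> BX (\<lambda>\<gamma>. \<gamma> t)" if "t \<in> {0..1}" for t
  proof (rule measure_eqI)
    fix A assume "A \<in> sets (distr M BX (\<lambda>\<gamma>. \<gamma> t))"
    then have A [measurable]: "A \<in> sets BX" by simp
    have [measurable]: "(\<lambda>\<gamma>. \<gamma> t) \<in> \<eta> \<rightarrow>\<^sub>M BX"
      using measurable_curves_eval[OF that, of X] by (simp cong: measurable_cong_sets add: sets)
    have "emeasure (distr M BX (\<lambda>\<gamma>. \<gamma> t)) A = emeasure M ((\<lambda>\<gamma>. \<gamma> t) -` A \<inter> Geo X)"
      by (subst emeasure_distr[OF e[OF that] A]) (simp add: spM)
    also have "\<dots> = emeasure \<eta> ((\<lambda>\<gamma>. \<gamma> t) -` A \<inter> Geo X)"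
      unfolding M_def by (subst emeasure_restrict_space) (use Geo in auto)
    also have "\<dots> = emeasure \<eta> ((\<lambda>\<gamma>. \<gamma> t) -` A \<inter> space \<eta>)"
    proof (rule emeasure_eq_AE)
      show "AE \<gamma> in \<eta>. (\<gamma> \<in> (\<lambda>\<gamma>. \<gamma> t) -` A \<inter> Geo X) = (\<gamma> \<in> (\<lambda>\<gamma>. \<gamma> t) -` A \<inter> space \<eta>)"
        using AE_Geo by eventually_elim (use GeoX sp in auto)
      have "(\<lambda>\<gamma>. \<gamma> t) -` A \<inter> Geo X = ((\<lambda>\<gamma>. \<gamma> t) -` A \<inter> space \<eta>) \<inter> Geo X"
        using GeoX sp by auto
      also have "\<dots> \<in> sets \<eta>" by measurable
      finally show "(\<lambda>\<gamma>. \<gamma> t) -` A \<inter> Geo X \<in> sets \<eta>" .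
    qed measurable
    also have "\<dots> = emeasure (distr \<eta> BX (\<lambda>\<gamma>. \<gamma> t)) A"
      by (simp add: emeasure_distr)
    finally show "emeasure (distr M BX (\<lambda>\<gamma>. \<gamma> t)) A = emeasure (distr \<eta> BX (\<lambda>\<gamma>. \<gamma> t)) A" .
  qed simp
  note disp = OptGeo_displacement[OF \<eta>]
  have M0: "distr M BX (\<lambda>\<gamma>. \<gamma> 0) = \<mu>0" and M1: "distr M BX (\<lambda>\<gamma>. \<gamma> 1) = \<mu>1"
    using distr_M[of 0] distr_M[of 1] disp by auto

  have e0: "(\<lambda>\<gamma>. \<gamma> 0) \<in> \<eta> \<rightarrow>\<^sub>M BX"
    using measurable_curves_eval[of 0 X] by (simp cong: measurable_cong_sets add: sets)
  have "AE p in distr \<eta> BX (\<lambda>\<gamma>. \<gamma> 0). snd p = 0 \<and> fst p \<in> {-1..-1 + h}"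
    unfolding disp(1) by (rule \<mu>0_AE)
  then have "AE \<gamma> in \<eta>. snd (\<gamma> 0) = 0 \<and> fst (\<gamma> 0) \<in> {-1..-1 + h}"
    by (rule AE_distrD[OF e0])
  then have "AE \<gamma> in \<eta>. \<gamma> \<in> Geo X \<longrightarrow> snd (\<gamma> 0) = 0 \<and> fst (\<gamma> 0) \<in> {-1..-1 + h} \<and> fst (\<gamma> \<tau>) = fst (\<gamma> 0) + (1 + k)"
    using disp(3) by eventually_elim (use Geo_fst_affine[OF _ _ _ \<tau>'] \<tau>(3) in auto)
  then have AE_M: "AE \<gamma> in M. snd (\<gamma> 0) = 0 \<and> fst (\<gamma> 0) \<in> {-1..-1 + h} \<and> fst (\<gamma> \<tau>) = fst (\<gamma> 0) + (1 + k)"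
    unfolding M_def using Geo by (subst AE_restrict_space_iff) auto

  obtain s where s: "0 \<le> s" "s \<le> 1" "emeasure (fibre_measure K) {..s} \<le> ennreal (fibre_mass K / 2)"
      "emeasure (fibre_measure K) {s<..} \<le> ennreal (fibre_mass K / 2)"
    by (rule fibre_median)
  \<comment> \<open>The curves that are in the lower half of their fibre at time
    \<open>\<tau>\<close>; the selection is conditioned on the position at time 0.\<close>
  define A where "A = {\<gamma> \<in> space M. snd (\<gamma> \<tau>) \<le> s * f (fst (\<gamma> \<tau>))}"
  have A: "A \<in> sets M" unfolding A_def by measurable
  obtain F :: "(real \<Rightarrow> real \<times> real) \<Rightarrow> real" and D where F [measurable]: "F \<in> borel_measurable M" and F0: "\<And>\<gamma>. 0 \<le> F \<gamma>" and F2: "\<And>\<gamma>. F \<gamma> \<le> 2"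
    and D: "D \<in> sets BX" and FD: "\<And>\<gamma>. \<gamma> \<in> space M \<Longrightarrow> F \<gamma> \<noteq> 0 \<Longrightarrow> \<gamma> 0 \<in> D \<longleftrightarrow> \<gamma> \<in> A"
    and Fd: "distr (density M F) BX (\<lambda>\<gamma>. \<gamma> 0) = distr M BX (\<lambda>\<gamma>. \<gamma> 0)"
    by (rule selecting_weight[OF \<open>prob_space M\<close> e_meas(1) A]) blast
  define \<nu> where "\<nu> t = distr (density M F) BX (\<lambda>\<gamma>. \<gamma> t)" for t
  have wm: "weighted_marginal X \<eta> F = \<nu>"
    by (rule ext) (simp add: weighted_marginal_def \<nu>_def M_def)
  have \<nu>0: "\<nu> 0 = \<mu>0" using Fd M0 by (simp add: \<nu>_def)
  have top: "subgraph f \<in> sets BX" using sets.top[of BX] by simp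
  have "(\<lambda>\<gamma>. \<gamma> 0) -` subgraph f \<inter> space M = space M"
    using measurable_space[OF e_meas(1)] by auto
  then have "emeasure (density M F) (space M) = emeasure (\<nu> 0) (subgraph f)"
    unfolding \<nu>_def by (subst emeasure_distr) (use top in simp_all)
  also have "\<dots> = 1"
    using prob_space.emeasure_space_1[OF prob_space_\<mu>(1)] by (simp add: \<nu>0 \<mu>0_def)
  finally have mass: "emeasure (density M F) (space M) = 1" .
  then have one: "(\<integral>\<^sup>+ \<gamma>. ennreal (F \<gamma>) \<partial>M) = 1"
    by (simp add: emeasure_density cong: nn_integral_cong)
  have "prob_space (density M F)" using mass by (intro prob_spaceI) simp
  then have prob: "prob_space (\<nu> t)" if "t \<in> {0..1}" for t
    unfolding \<nu>_def using e[OF that] by (intro prob_space.prob_space_distr) auto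
  have sets_\<nu>: "sets (\<nu> t) = sets m" for t by (simp add: \<nu>_def)

  have "Ent m (\<nu> \<tau>) \<le> ereal (1 - \<tau>) * Ent m (\<nu> 0) + ereal \<tau> * Ent m (\<nu> 1)"
    unfolding wm[symmetric]
  proof (rule CD[rule_format])
    show "F \<in> borel_measurable (restrict_space (borel_of_metric (curves X)) (Geo X))"
      using F unfolding M_def by (simp add: sets cong: measurable_cong_sets restrict_space_sets_cong)
  qed (use F0 F2 one in \<open>auto simp: M_def\<close>)
  \<comment> \<open>The initial marginal is still \<open>\<mu>0\<close>, with density at most
    \<open>c\<close>; the final one is at most twice \<open>\<mu>1\<close>, because the weight is at
    most 2.\<close>
  also have "\<dots> \<le> ereal (1 - \<tau>) * ereal (ln c) + ereal \<tau> * ereal (ln (2 * c))"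
  proof (intro add_mono ereal_mult_left_mono)
    show "Ent m (\<nu> 0) \<le> ereal (ln c)"
    proof (rule Ent_le_ln)
      show "emeasure (\<nu> 0) B \<le> ennreal c * emeasure m B" if "B \<in> sets m" for B
        using \<mu>0_le that by (simp add: \<nu>0)
    qed (use c_pos prob[of 0] sets_\<nu> finite_measure_m in auto)
    show "Ent m (\<nu> 1) \<le> ereal (ln (2 * c))"
    proof (rule Ent_le_ln)
      fix B assume "B \<in> sets m"
      then have B [measurable]: "B \<in> sets BX" by simp
      have "emeasure (\<nu> 1) B = (\<integral>\<^sup>+\<gamma>. ennreal (F \<gamma>) * indicator ((\<lambda>\<gamma>. \<gamma> 1) -` B \<inter> space M) \<gamma> \<partial>M)"
        unfolding \<nu>_def by (simp add: emeasure_distr emeasure_density)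
      also have "\<dots> \<le> (\<integral>\<^sup>+\<gamma>. 2 * indicator ((\<lambda>\<gamma>. \<gamma> 1) -` B \<inter> space M) \<gamma> \<partial>M)"
        using F2 by (intro nn_integral_mono mult_right_mono) (auto simp: ennreal_le_iff simp flip: ennreal_numeral)
      also have "\<dots> = 2 * emeasure M ((\<lambda>\<gamma>. \<gamma> 1) -` B \<inter> space M)"
        by (subst nn_integral_cmult) auto
      also have "\<dots> = 2 * emeasure \<mu>1 B"
        unfolding M1[symmetric] by (simp add: emeasure_distr)
      also have "\<dots> \<le> 2 * (ennreal c * emeasure m B)"
        using \<mu>1_le[OF B] by (intro mult_left_mono) auto
      also have "\<dots> = ennreal (2 * c) * emeasure m B"
        using c_pos by (simp only: ennreal_mult' ennreal_numeral mult.assoc zero_le_numeral)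
      finally show "emeasure (\<nu> 1) B \<le> ennreal (2 * c) * emeasure m B" .
    qed (use c_pos prob[of 1] sets_\<nu> finite_measure_m in auto)
  qed (use \<tau> in auto)
  finally have upper: "Ent m (\<nu> \<tau>) \<le> ereal ((1 - \<tau>) * ln c + \<tau> * ln (2 * c))" by simp

  define S where "S = {p \<in> subgraph f. fst p \<in> {k..k + h} \<and>
      ((fst p - (1 + k), 0) \<in> D \<longleftrightarrow> snd p \<le> s * f (fst p))}"
  note S = emeasure_half_slab[OF s(3,4) D, folded S_def]
  have "ereal (- ln (1 / (2 * c))) \<le> Ent m (\<nu> \<tau>)"
  proof (rule Ent_ge_minus_ln)
    have "AE \<gamma> in M. 0 < ennreal (F \<gamma>) \<longrightarrow> \<gamma> \<tau> \<in> S"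
      using AE_M AE_space
    proof eventually_elim
      case (elim \<gamma>)
      then have "\<gamma> \<in> mspace (curves X)" using spM GeoX by auto
      then have "\<gamma> \<tau> \<in> subgraph f" using \<tau>' by (rule curve_in_subgraph)
      \<comment> \<open>The starting point is recovered from the position at time
        \<open>\<tau>\<close>. Membership of the starting point in \<open>D\<close>, which agrees
        with membership of the curve in \<open>A\<close> where the weight is nonzero, thus becomes
        the condition defining \<open>S\<close>.\<close>
      moreover have "\<gamma> 0 = (fst (\<gamma> \<tau>) - (1 + k), 0)" using elim by (simp add: prod_eq_iff)
      ultimately show ?case
        using elim FD[of \<gamma>] h by (auto simp: S_def A_def)
    qed
    then have "AE \<gamma> in density M F. \<gamma> \<tau> \<in> S" by (subst AE_density) auto
    moreover have "{p \<in> space BX. p \<in> S} \<in> sets BX" using S(1) by measurable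
    moreover have "(\<lambda>\<gamma>. \<gamma> \<tau>) \<in> density M F \<rightarrow>\<^sub>M BX" by measurable
    ultimately show "AE p in \<nu> \<tau>. p \<in> S"
      unfolding \<nu>_def by (simp only: AE_distr_iff)
  qed (use finite_measure_m prob[OF \<tau>'] sets_\<nu> S c_pos in auto)
  also note upper
  finally have "- ln (1 / (2 * c)) \<le> (1 - \<tau>) * ln c + \<tau> * ln (2 * c)" by simp
  \<comment> \<open>The two sides are \<open>ln y + \<tau> * ln 2\<close> and
    \<open>ln y + ln 2\<close>, so the strict inequality is exactly
    \<open>\<tau> < 1\<close>.\<close>
  moreover have "(1 - \<tau>) * ln y + \<tau> * ln (2 * y) < - ln (1 / (2 * y))" if "0 < y" for y :: real
  proof -
    have "\<tau> * ln 2 < ln 2" using \<tau> by simp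
    then show ?thesis using that by (simp add: ln_div ln_mult_pos algebra_simps)
  qed
  ultimately show False using c_pos by (meson not_less)
qed

end

section \<open>The profile function\<close>

lemma subgraph_cong:
  assumes "\<And>x. x \<in> {-1..1} \<Longrightarrow> f x = g x"
  shows "subgraph f = subgraph g" "subgraph_space f = subgraph_space g"
proof -
  show "subgraph f = subgraph g"
  proof (rule set_eqI)
    fix p :: "real \<times> real"
    show "p \<in> subgraph f \<longleftrightarrow> p \<in> subgraph g"
      using assms[of "fst p"] by (cases p) (auto simp: subgraph_def)
  qed
  then show "subgraph_space f = subgraph_space g" by (simp add: subgraph_space_def)
qed

text \<open>Allows the profile to be replaced by an extension with global measurability and bounds.
  The defining formula mentions \<open>f\<close> at all reals, but is evaluated only on subsets of
  the subgraph, whose first coordinates lie in \<open>{-1..1}\<close>.\<close>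

lemma subgraph_measure_cong:
  assumes "\<And>x. x \<in> {-1..1} \<Longrightarrow> f x = g x"
  shows "subgraph_measure f K = subgraph_measure g K"
proof -
  have S: "subgraph f = subgraph g" "subgraph_space f = subgraph_space g"
    using subgraph_cong[of f g, OF assms] by simp_all
  show ?thesis
    unfolding subgraph_measure_def S
  proof (rule measure_of_eq)
    let ?\<Sigma> = "sets (borel_of_metric (subgraph_space g))"
    show "?\<Sigma> \<subseteq> Pow (subgraph g)" using sets.space_closed[of "borel_of_metric (subgraph_space g)"] by simp
    fix A assume "A \<in> sigma_sets (subgraph g) ?\<Sigma>"
    then have "A \<subseteq> subgraph g"
      by (rule sigma_sets_into_sp[rotated]) (use sets.space_closed[of "borel_of_metric (subgraph_space g)"] in simp)
    have eq: "f (fst p) = g (fst p)" if "p \<in> A" for p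
    proof -
      have "p \<in> subgraph g" using that \<open>A \<subseteq> subgraph g\<close> by blast
      then show ?thesis using assms[of "fst p"] by (cases p) (simp add: subgraph_def)
    qed
    have "p \<in> A \<inter> {(x, y). x \<in> {-1..1} \<and> f x = 0 \<and> y = 0} \<longleftrightarrow> p \<in> A \<inter> {(x, y). x \<in> {-1..1} \<and> g x = 0 \<and> y = 0}" for p
      using eq[of p] by (cases p) auto
    then have "A \<inter> {(x, y). x \<in> {-1..1} \<and> f x = 0 \<and> y = 0} = A \<inter> {(x, y). x \<in> {-1..1} \<and> g x = 0 \<and> y = 0}"
      by blast
    moreover have "(\<integral>\<^sup>+ p \<in> A \<inter> {(x, y). f x > 0}. ennreal (1 / f (fst p) * exp (- K * (snd p / f (fst p))\<^sup>2)) \<partial>lborel)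
        = (\<integral>\<^sup>+ p \<in> A \<inter> {(x, y). g x > 0}. ennreal (1 / g (fst p) * exp (- K * (snd p / g (fst p))\<^sup>2)) \<partial>lborel)"
    proof (rule nn_integral_cong)
      fix p :: "real \<times> real"
      show "ennreal (1 / f (fst p) * exp (- K * (snd p / f (fst p))\<^sup>2)) * indicator (A \<inter> {(x, y). f x > 0}) p
          = ennreal (1 / g (fst p) * exp (- K * (snd p / g (fst p))\<^sup>2)) * indicator (A \<inter> {(x, y). g x > 0}) p"
        using eq[of p] by (cases "p \<in> A"; cases p) (simp_all add: indicator_def)
    qed
    ultimately show "ennreal (integral {0..1} (\<lambda>y. exp (- K * y\<^sup>2))) *
          hausdorff1 (subgraph_space g) (A \<inter> {(x, y). x \<in> {-1..1} \<and> f x = 0 \<and> y = 0})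
        + (\<integral>\<^sup>+ p \<in> A \<inter> {(x, y). f x > 0}. ennreal (1 / f (fst p) * exp (- K * (snd p / f (fst p))\<^sup>2)) \<partial>lborel)
      = ennreal (integral {0..1} (\<lambda>y. exp (- K * y\<^sup>2))) *
          hausdorff1 (subgraph_space g) (A \<inter> {(x, y). x \<in> {-1..1} \<and> g x = 0 \<and> y = 0})
        + (\<integral>\<^sup>+ p \<in> A \<inter> {(x, y). g x > 0}. ennreal (1 / g (fst p) * exp (- K * (snd p / g (fst p))\<^sup>2)) \<partial>lborel)"
      by simp
  qed
qed

text \<open>Integrating twice from -1: the slope stays between 0 and \<open>k\<close>, so
  \<open>f\<close> is at most \<open>2 * k\<close>, which is below 1.\<close>

lemma profile_properties:
  fixes k :: real and \<phi> f f' :: "real \<Rightarrow> real"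
  assumes k: "0 < k" "k < 1/2"
    and \<phi>: "\<And>x. 0 \<le> \<phi> x" "(\<phi> has_integral k) UNIV" "\<And>x. x \<notin> {-k..k} \<Longrightarrow> \<phi> x = 0"
    and f: "\<And>x. x \<in> {-1..1} \<Longrightarrow> (f has_real_derivative f' x) (at x within {-1..1})"
    and f': "\<And>x. x \<in> {-1..1} \<Longrightarrow> (f' has_real_derivative \<phi> x) (at x within {-1..1})"
    and init: "f' (-1) = 0" "f (-1) = 0"
  shows "\<And>x. x \<in> {-1..1} \<Longrightarrow> 0 \<le> f x" "\<And>x. x \<in> {-1..1} \<Longrightarrow> f x \<le> 1"
    "\<And>x. -1 \<le> x \<Longrightarrow> x \<le> -k \<Longrightarrow> f x = 0" "\<And>x. k \<le> x \<Longrightarrow> x \<le> 1 \<Longrightarrow> 0 < f x"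
proof -
  have ftc: "(G' has_integral G x - G (-1)) {-1..x}"
    if G: "\<And>x. x \<in> {-1..1} \<Longrightarrow> (G has_real_derivative G' x) (at x within {-1..1})" and x: "x \<in> {-1..1}" for G G' x
  proof (rule fundamental_theorem_of_calculus)
    fix y assume "y \<in> {-1..x}"
    then have "(G has_real_derivative G' y) (at y within {-1..x})"
      using x by (intro has_field_derivative_subset[OF G]) auto
    then show "(G has_vector_derivative G' y) (at y within {-1..x})"
      by (simp add: has_real_derivative_iff_has_vector_derivative)
  qed (use x in simp)
  have If': "(\<phi> has_integral f' x) {-1..x}" if "x \<in> {-1..1}" for x
    using ftc[OF f' that] init by simp
  have If: "(f' has_integral f x) {-1..x}" if "x \<in> {-1..1}" for x
    using ftc[OF f that] init by simp
  have f'0: "0 \<le> f' x" if "x \<in> {-1..1}" for x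
    by (rule has_integral_nonneg[OF If'[OF that] \<phi>(1)])
  have f'1: "f' x \<le> k" if "x \<in> {-1..1}" for x
    by (rule has_integral_subset_le[OF _ If'[OF that] \<phi>(2)]) (use \<phi>(1) in auto)
  show f0: "0 \<le> f x" if "x \<in> {-1..1}" for x
    by (rule has_integral_nonneg[OF If[OF that]]) (use f'0 that in auto)
  show "f x \<le> 1" if "x \<in> {-1..1}" for x
  proof -
    have "f x \<le> (x - (-1)) * k"
      using has_integral_le[OF If[OF that] has_integral_const_real[of k "-1" x]] f'1 that by auto
    also have "\<dots> \<le> 2 * k" using that k by (intro mult_right_mono) auto
    finally show ?thesis using k by simp
  qed
  have f'z: "f' x = 0" if "-1 \<le> x" "x \<le> -k" for x
  proof -
    \<comment> \<open>The endpoint \<open>-k\<close> may belong to the interval while the support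
      hypothesis says nothing there; one point does not change the integral.\<close>
    have "(\<phi> has_integral 0) {-1..x}"
      by (rule has_integral_spike_finite[of "{-k}" _ _ "\<lambda>_. 0"]) (use \<phi>(3) that in auto)
    moreover have "x \<in> {-1..1}" using that k by auto
    ultimately show ?thesis by (intro has_integral_unique[OF If'])
  qed
  show "f x = 0" if "-1 \<le> x" "x \<le> -k" for x
  proof -
    have "(f' has_integral 0) {-1..x}"
      by (rule has_integral_is_0) (use f'z that in auto)
    moreover have "x \<in> {-1..1}" using that k by auto
    ultimately show ?thesis by (intro has_integral_unique[OF If])
  qed
  \<comment> \<open>All of the mass of \<open>\<phi>\<close> has been collected by \<open>k\<close>,
    so the slope there is \<open>k\<close>.\<close>
  have "(\<lambda>x. if x \<in> {-1..k} then \<phi> x else 0) = \<phi>"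
    using \<phi>(3) k by (force simp: fun_eq_iff)
  then have "(\<phi> has_integral k) {-1..k}"
    using \<phi>(2) has_integral_restrict_UNIV[of "{-1..k}" \<phi> k] by simp
  then have f'k: "f' k = k"
    using k by (intro has_integral_unique[OF If']) auto
  \<comment> \<open>If \<open>f\<close> vanished at \<open>x\<close>, the continuous nonnegative
    slope would have integral 0 over \<open>{-1..x}\<close> and so vanish at \<open>k\<close>, where
    it equals \<open>k > 0\<close>.\<close>
  show "0 < f x" if "k \<le> x" "x \<le> 1" for x
  proof (rule ccontr)
    have x: "x \<in> {-1..1}" using that k by auto
    assume "\<not> 0 < f x"
    then have "f x = 0" using f0[OF x] by simp
    then have int: "(f' has_integral 0) (cbox (-1) x)" using If[OF x] by simp
    have "continuous_on {-1..1} f'"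
      by (rule DERIV_continuous_on[OF f'])
    then have "continuous_on (cbox (-1) x) f'"
      using x by (auto elim: continuous_on_subset)
    then have "f' k = 0"
      by (rule has_integral_0_cbox_imp_0) (use int f'0 x that k in auto)
    then show False using f'k k by simp
  qed
qed

theorem proposition7p5:
  fixes k K :: real and \<phi> f f' :: "real \<Rightarrow> real"
  assumes "0 < k" and "k < 1/2" and "1 \<le> K"
    and "continuous_on UNIV \<phi>" and "\<And>x. \<phi> x \<in> {0..1}"
    and "(\<phi> has_integral k) UNIV" and "\<And>x. x \<notin> {-k..k} \<Longrightarrow> \<phi> x = 0"
    and "\<And>x. x \<in> {-1..1} \<Longrightarrow> (f has_real_derivative f' x) (at x within {-1..1})"
    and "\<And>x. x \<in> {-1..1} \<Longrightarrow> (f' has_real_derivative \<phi> x) (at x within {-1..1})"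
    and "f' (-1) = 0" and "f (-1) = 0"
  shows "\<not> strict_CD 0 (subgraph_space f) (subgraph_measure f K)"
proof -
  \<comment> \<open>Clamping the argument extends \<open>f\<close> constantly beyond the endpoints:
    continuity gives Borel measurability, and the bounds on \<open>{-1..1}\<close> become
    global.\<close>
  define g where "g x = f (max (-1) (min 1 x))" for x
  have fg: "f x = g x" if "x \<in> {-1..1}" for x
    using that by (simp add: g_def)
  have clamp: "max (-1) (min 1 x) \<in> {-1..1}" for x :: real by auto
  have nonneg: "\<And>x. 0 \<le> \<phi> x" using assms(5) by simp
  have profile: "0 \<le> f x" "f x \<le> 1" if "x \<in> {-1..1}" for x
    by (rule profile_properties(1,2)[of k \<phi> f f']; fact)+
  have profile_zero: "f x = 0" if "-1 \<le> x" "x \<le> -k" for x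
    by (rule profile_properties(3)[of k \<phi> f f']; fact)
  have profile_pos: "0 < f x" if "k \<le> x" "x \<le> 1" for x
    by (rule profile_properties(4)[of k \<phi> f f']; fact)
  have "continuous_on {-1..1} f"
    by (rule DERIV_continuous_on[OF assms(8)])
  moreover have "continuous_on UNIV (\<lambda>x::real. max (-1) (min 1 x))"
    by (intro continuous_on_max continuous_on_min continuous_on_const continuous_on_id)
  ultimately have "continuous_on UNIV g"
    unfolding g_def by (rule continuous_on_compose2) (use clamp in auto)
  then have "g \<in> borel_measurable borel"
    by (rule borel_measurable_continuous_onI)
  then interpret needle g K k
  proof (rule needle.intro)
    show "0 < k" "k < 1" using assms(1,2) by auto
    show "0 \<le> g x" "g x \<le> 1" for x
      unfolding g_def by (rule profile[OF clamp])+
    show "g x = 0" if "-1 \<le> x" "x \<le> -k" for x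
      using profile_zero[OF that] that \<open>0 < k\<close> fg[of x] \<open>k < 1\<close> by simp
    show "0 < g x" if "k \<le> x" "x \<le> 1" for x
      using profile_pos[OF that] that \<open>0 < k\<close> fg[of x] by simp
  qed
  show ?thesis
    using not_strict_CD subgraph_cong(2)[of f g, OF fg] subgraph_measure_cong[of f g K, OF fg] by simp
qed

end
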